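(* Let $\theta>0$, $n\ge1$, and let $\{P_1,\ldots,P_n,Y_1,\ldots,Y_n\}$ be independent random variables where $P_k$ is Poisson with mean $\theta/k$ and $Y_k$ is non-negative with $E[Y_k]=k$ and $\mathrm{Var}(Y_k)=\sigma_k^2<\infty$, for $k=1,\ldots,n$. Let $$W_n=\frac1n\sum_{k=1}^nY_kP_k,$$ and let $D_\theta$ have the generalized Dickman distribution $\mathcal{D}_\theta$. Then $$d_{1,1}(W_n,D_\theta)\le\frac{\theta}{4n}+\frac{\theta}{n}\sum_{k=1}^n\frac{\sigma_k}{k}+\frac{\theta}{2n^2}\sum_{k=1}^n\frac1k\sqrt{(\sigma_k^2+k^2)\sigma_k^2}.$$ In particular, in the case $Y_k=k$ almost surely for all $k$, $W_n=\frac1n\sum_{k=1}^n kP_k$ satisfies $$d_{1,1}(W_n,D_\theta)\le\frac{\theta}{4n}.$$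
   Context: For $\theta>0$, the generalized Dickman distribution $\mathcal{D}_\theta$ is the unique law of a non-negative random variable $W$ satisfying $W=_d U^{1/\theta}(W+1)$, where $U\sim\mathcal{U}[0,1]$ is independent of $W$ and $=_d$ is equality in distribution. For $\alpha\ge 0$, $\mathrm{Lip}_\alpha$ is the set of real-valued functions $h$ with $|h(x)-h(y)|\le\alpha|x-y|$ for all $x,y$. For $\alpha,\beta\ge0$, $\mathcal{H}_{\alpha,\beta}$ is the set of differentiable functions $h:[0,\infty)\to\mathbb{R}$ with $h\in\mathrm{Lip}_\alpha$ and $h'\in\mathrm{Lip}_\beta$. For non-negative random variables $X,Y$, $d_{1,1}(X,Y)=\sup_{h\in\mathcal{H}_{1,1}}|E h(Y)-E h(X)|$. *)

theory Defs
  imports "HOL-Probability.Probability"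
begin

text \<open>
  The law \<open>D\<close> on the reals is the generalized Dickman distribution: if \<open>W\<close> has law \<open>D\<close> and
  \<open>U\<close> is uniform on \<open>[0,1]\<close> and independent of \<open>W\<close> (so that the pair \<open>(U, W)\<close> has the product
  law), then \<open>W\<close> is a.s. non-negative and \<open>W\<close> and \<open>U\<^sup>1\<^sup>/\<^sup>\<theta> (W + 1)\<close> have the same law.
\<close>
definition generalized_dickman :: "real \<Rightarrow> real measure \<Rightarrow> bool" where
  "generalized_dickman \<theta> D \<longleftrightarrow>
     prob_space D \<and> sets D = sets borel \<and> (AE w in D. 0 \<le> w) \<and>
     D = distr (uniform_measure lborel {0..1} \<Otimes>\<^sub>M D) borel
           (\<lambda>(u, w). u powr (1 / \<theta>) * (w + 1))"

text \<open>
  A function on \<open>[0,\<infinity>)\<close> is represented by a total function whose values at negative arguments are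
  unconstrained; the derivative at \<open>0\<close> is one-sided.
\<close>
definition smooth_test :: "real \<Rightarrow> real \<Rightarrow> (real \<Rightarrow> real) set" where
  "smooth_test \<alpha> \<beta> =
     {h. \<alpha>-lipschitz_on {0..} h \<and>
         (\<exists>h'. (\<forall>x\<ge>0. (h has_real_derivative h' x) (at x within {0..})) \<and>
               \<beta>-lipschitz_on {0..} h')}"

text \<open>
  The mean of \<open>h(X)\<close> for an a.s. non-negative random variable \<open>X\<close>. Restricting the integral to
  \<open>[0,\<infinity>)\<close> makes it independent of the (possibly non-measurable) values of \<open>h\<close> at negative
  arguments.
\<close>
definition mean_of :: "'a measure \<Rightarrow> ('a \<Rightarrow> real) \<Rightarrow> (real \<Rightarrow> real) \<Rightarrow> real" where
  "mean_of M X h = (LINT x:{0..}|distr M borel X. h x)"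

text \<open>The supremum is taken in the extended reals, so an unbounded set gives \<open>\<infinity>\<close>.\<close>
definition d11 :: "'a measure \<Rightarrow> ('a \<Rightarrow> real) \<Rightarrow> 'b measure \<Rightarrow> ('b \<Rightarrow> real) \<Rightarrow> ereal" where
  "d11 M X N Y = (SUP h\<in>smooth_test 1 1. ereal \<bar>mean_of N Y h - mean_of M X h\<bar>)"

end

theory Submission
  imports Defs
begin

text \<open>
  The proof is Stein's method, run with an approximate solution of the Stein equation. Write
  \<open>Ag(x) = E g(U\<^sup>1\<^sup>/\<^sup>\<theta> x)\<close> for the average of \<open>g\<close> along the random dilation in the definition of the
  Dickman law. Integrating the derivative of \<open>u g(u\<^sup>1\<^sup>/\<^sup>\<theta> x)\<close> over \<open>[0,1]\<close> gives the differential
  equation \<open>(x/\<theta>) (Ag)' + Ag = g\<close>, and the fixed point equation of \<open>D\<^sub>\<theta>\<close> says that \<open>g\<close> and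
  \<open>x \<mapsto> Ag(x + 1)\<close> have the same mean under \<open>D\<^sub>\<theta>\<close>. Hence, with \<open>h\<^sub>0 = h\<close>, \<open>h\<^sub>k\<^sub>+\<^sub>1(x) = Ah\<^sub>k(x + 1)\<close> and
  \<open>f = \<Sum>k<m. Ah\<^sub>k\<close>, the sum telescopes to
  \<open>(x/\<theta>) f'(x) + f(x) - f(x + 1) = h(x) - h\<^sub>m(x)\<close>, where \<open>E h\<^sub>m(D\<^sub>\<theta>) = E h(D\<^sub>\<theta>)\<close>
  (\<open>truncated_dickman_stein_solution\<close>).

  Each application of \<open>A\<close> multiplies the Lipschitz constant of a function by
  \<open>E U\<^sup>1\<^sup>/\<^sup>\<theta> = \<theta>/(\<theta>+1)\<close> and that of its derivative by \<open>E U\<^sup>2\<^sup>/\<^sup>\<theta> = \<theta>/(\<theta>+2)\<close>. The two geometric series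
  sum to \<open>\<theta>\<close> and \<open>\<theta>/2\<close>, which bounds \<open>f'\<close> and the Lipschitz constant of \<open>f'\<close> for every \<open>m\<close>. The
  remainder \<open>h\<^sub>m\<close> has Lipschitz constant \<open>(\<theta>/(\<theta>+1))\<^sup>m\<close>, so \<open>E h\<^sub>m(W\<^sub>n) - E h\<^sub>m(D\<^sub>\<theta>)\<close> vanishes as \<open>m\<close>
  grows (\<open>dickman_distance_from_stein_bound\<close>). This uses that \<open>D\<^sub>\<theta>\<close> has a finite mean, which also
  follows from the fixed point equation (\<open>generalized_dickman_integrable\<close>).

  It remains to bound \<open>E[(W/\<theta>) f'(W) + f(W) - f(W+1)]\<close> for \<open>W = W\<^sub>n\<close>. The Poisson identity
  \<open>E[P \<phi>(P)] = E[P] E[\<phi>(P+1)]\<close> turns \<open>E[(W/\<theta>) f'(W)]\<close> into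
  \<open>(1/n) \<Sum>k. E[(Y\<^sub>k/k) f'(W + Y\<^sub>k/n)]\<close>. Replacing \<open>Y\<^sub>k\<close> by its mean \<open>k\<close> costs the two terms with
  \<open>\<sigma>\<^sub>k\<close>, by the Cauchy-Schwarz inequality, and leaves a right Riemann sum of \<open>f'\<close> over \<open>[W, W+1]\<close>,
  which differs from \<open>f(W+1) - f(W)\<close> by at most \<open>(\<theta>/2)/(2n)\<close>
  (\<open>weighted_poisson_stein_bound\<close>).
\<close>

section \<open>Functions on the line with bounded Lipschitz derivative\<close>

text \<open>
  The class of test functions carried over to the whole line, so that the derivative is two-sided
  everywhere; the derivative is an argument because the Stein equation involves it.
\<close>
definition has_lipschitz_deriv ::
  "real \<Rightarrow> real \<Rightarrow> (real \<Rightarrow> real) \<Rightarrow> (real \<Rightarrow> real) \<Rightarrow> bool" where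
  "has_lipschitz_deriv a b g g' \<longleftrightarrow>
     (\<forall>x. (g has_real_derivative g' x) (at x)) \<and> (\<forall>x. \<bar>g' x\<bar> \<le> a) \<and>
     (\<forall>x y. \<bar>g' x - g' y\<bar> \<le> b * \<bar>x - y\<bar>)"

lemma has_lipschitz_derivD:
  assumes "has_lipschitz_deriv a b g g'"
  shows "(g has_real_derivative g' x) (at x)" "\<bar>g' x\<bar> \<le> a" "\<bar>g' x - g' y\<bar> \<le> b * \<bar>x - y\<bar>"
  using assms unfolding has_lipschitz_deriv_def by blast+

lemma has_lipschitz_deriv_nonneg:
  assumes "has_lipschitz_deriv a b g g'"
  shows "0 \<le> a" "0 \<le> b"
  using has_lipschitz_derivD(2)[OF assms, of 0] has_lipschitz_derivD(3)[OF assms, of 0 1] by auto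

lemma has_lipschitz_deriv_continuous:
  assumes "has_lipschitz_deriv a b g g'"
  shows "continuous_on S g" "continuous_on S g'"
proof -
  show "continuous_on S g"
    using has_lipschitz_derivD(1)[OF assms] DERIV_isCont
    by (metis continuous_at_imp_continuous_on)
  have "b-lipschitz_on UNIV g'"
    using has_lipschitz_derivD(3)[OF assms] has_lipschitz_deriv_nonneg(2)[OF assms]
    by (intro lipschitz_onI) (auto simp: dist_real_def)
  from lipschitz_on_continuous_on[OF this] show "continuous_on S g'"
    using continuous_on_subset by blast
qed

lemma has_lipschitz_deriv_measurable:
  assumes "has_lipschitz_deriv a b g g'"
  shows "g \<in> borel_measurable borel" "g' \<in> borel_measurable borel"
  using has_lipschitz_deriv_continuous[OF assms] by (auto intro: borel_measurable_continuous_onI)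

lemma has_lipschitz_deriv_lipschitz:
  assumes "has_lipschitz_deriv a b g g'"
  shows "\<bar>g x - g y\<bar> \<le> a * \<bar>x - y\<bar>"
proof -
  have "norm (g x - g y) \<le> a * norm (x - y)"
    by (rule field_differentiable_bound[of UNIV g g'])
       (use has_lipschitz_derivD[OF assms] in auto)
  then show ?thesis by simp
qed

lemma has_lipschitz_deriv_growth:
  assumes "has_lipschitz_deriv a b g g'"
  shows "\<bar>g x\<bar> \<le> \<bar>g 0\<bar> + a * \<bar>x\<bar>"
  using has_lipschitz_deriv_lipschitz[OF assms, of x 0] by simp

lemma has_lipschitz_deriv_mono:
  assumes "has_lipschitz_deriv a b g g'" "a \<le> c" "b \<le> d"
  shows "has_lipschitz_deriv c d g g'"
  unfolding has_lipschitz_deriv_def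
proof (intro conjI allI)
  fix x y
  show "(g has_real_derivative g' x) (at x)" by (rule has_lipschitz_derivD[OF assms(1)])
  show "\<bar>g' x\<bar> \<le> c" using has_lipschitz_derivD(2)[OF assms(1), of x] assms(2) by simp
  have "b * \<bar>x - y\<bar> \<le> d * \<bar>x - y\<bar>" using assms(3) by (intro mult_right_mono) auto
  then show "\<bar>g' x - g' y\<bar> \<le> d * \<bar>x - y\<bar>"
    using has_lipschitz_derivD(3)[OF assms(1), of x y] by simp
qed

lemma has_lipschitz_deriv_add:
  assumes "has_lipschitz_deriv a b g g'" "has_lipschitz_deriv c d h h'"
  shows "has_lipschitz_deriv (a + c) (b + d) (\<lambda>x. g x + h x) (\<lambda>x. g' x + h' x)"
  unfolding has_lipschitz_deriv_def
proof (intro conjI allI)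
  fix x y
  show "((\<lambda>x. g x + h x) has_real_derivative g' x + h' x) (at x)"
    using assms by (intro DERIV_add) (auto dest: has_lipschitz_derivD)
  show "\<bar>g' x + h' x\<bar> \<le> a + c"
    using has_lipschitz_derivD(2)[OF assms(1), of x] has_lipschitz_derivD(2)[OF assms(2), of x] by simp
  have "\<bar>g' x + h' x - (g' y + h' y)\<bar> \<le> \<bar>g' x - g' y\<bar> + \<bar>h' x - h' y\<bar>" by simp
  also have "\<dots> \<le> (b + d) * \<bar>x - y\<bar>"
    using has_lipschitz_derivD(3)[OF assms(1), of x y] has_lipschitz_derivD(3)[OF assms(2), of x y]
    by (simp add: algebra_simps)
  finally show "\<bar>g' x + h' x - (g' y + h' y)\<bar> \<le> (b + d) * \<bar>x - y\<bar>" .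
qed

lemma has_lipschitz_deriv_shift:
  assumes "has_lipschitz_deriv a b g g'"
  shows "has_lipschitz_deriv a b (\<lambda>x. g (x + c)) (\<lambda>x. g' (x + c))"
  unfolding has_lipschitz_deriv_def
proof (intro conjI allI)
  fix x y
  show "((\<lambda>x. g (x + c)) has_real_derivative g' (x + c)) (at x)"
    using has_lipschitz_derivD(1)[OF assms, of "x + c"] by (simp add: DERIV_shift)
  show "\<bar>g' (x + c)\<bar> \<le> a" by (rule has_lipschitz_derivD[OF assms])
  show "\<bar>g' (x + c) - g' (y + c)\<bar> \<le> b * \<bar>x - y\<bar>"
    using has_lipschitz_derivD(3)[OF assms, of "x + c" "y + c"] by simp
qed

text \<open>
  The constant \<open>1/2\<close> is what produces \<open>\<theta>/(4n)\<close> rather than \<open>\<theta>/(2n)\<close> in the end, and the mean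
  value theorem alone would lose it. The reason is that \<open>b/2 (t - x)\<^sup>2\<close> minus the signed
  remainder is monotone on either side of \<open>x\<close>, where it vanishes.
\<close>
lemma has_lipschitz_deriv_taylor:
  assumes "has_lipschitz_deriv a b g g'"
  shows "\<bar>g y - g x - g' x * (y - x)\<bar> \<le> b / 2 * (y - x)\<^sup>2"
proof -
  \<comment> \<open>The factor \<open>s\<close> gives both signs of the absolute value at once.\<close>
  have *: "s * (g y - g x - g' x * (y - x)) \<le> b / 2 * (y - x)\<^sup>2" if s: "s = 1 \<or> s = -1" for s :: real
  proof -
    define \<phi> where "\<phi> t = b / 2 * (t - x)\<^sup>2 - s * (g t - g x - g' x * (t - x))" for t
    define \<phi>' where "\<phi>' t = b * (t - x) - s * (g' t - g' x)" for t
    have D: "(\<phi> has_real_derivative \<phi>' t) (at t)" for t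
      unfolding \<phi>_def \<phi>'_def
      by (auto intro!: derivative_eq_intros has_lipschitz_derivD(1)[OF assms])
    have B: "\<bar>s * (g' t - g' x)\<bar> \<le> b * \<bar>t - x\<bar>" for t
      using has_lipschitz_derivD(3)[OF assms, of t x] s by auto
    have "0 \<le> \<phi> y"
    proof (cases "x \<le> y")
      case True
      have "\<phi> x \<le> \<phi> y"
      proof (rule DERIV_nonneg_imp_nondecreasing[OF True])
        fix t assume "x \<le> t" "t \<le> y"
        then show "\<exists>d. (\<phi> has_real_derivative d) (at t) \<and> 0 \<le> d"
          using D[of t] B[of t] unfolding \<phi>'_def by (intro exI[of _ "\<phi>' t"]) (auto simp: \<phi>'_def)
      qed
      then show ?thesis by (simp add: \<phi>_def)
    next
      case False
      then have "y \<le> x" by simp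
      have "\<phi> x \<le> \<phi> y"
      proof (rule DERIV_nonpos_imp_nonincreasing[OF \<open>y \<le> x\<close>])
        fix t assume "y \<le> t" "t \<le> x"
        then show "\<exists>d. (\<phi> has_real_derivative d) (at t) \<and> d \<le> 0"
          using D[of t] B[of t] unfolding \<phi>'_def
          by (intro exI[of _ "\<phi>' t"]) (auto simp: \<phi>'_def algebra_simps)
      qed
      then show ?thesis by (simp add: \<phi>_def)
    qed
    then show ?thesis by (simp add: \<phi>_def)
  qed
  show ?thesis by (rule abs_leI) (use *[of 1] *[of "-1"] in simp_all)
qed

text \<open>
  Continuing a test function linearly to the left of \<open>0\<close>, with its one-sided slope there, keeps both
  Lipschitz constants. This removes boundary cases from the differentiation and supplies the
  measurability that the values of a test function at negative arguments may lack.
\<close>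
lemma smooth_test_extend:
  assumes "h \<in> smooth_test \<alpha> \<beta>"
  obtains g g' where "has_lipschitz_deriv \<alpha> \<beta> g g'" "\<And>x. 0 \<le> x \<Longrightarrow> g x = h x"
proof -
  from assms obtain h' where lip: "\<alpha>-lipschitz_on {0..} h"
    and der: "\<And>x. x \<ge> 0 \<Longrightarrow> (h has_real_derivative h' x) (at x within {0..})"
    and lip': "\<beta>-lipschitz_on {0..} h'"
    unfolding smooth_test_def by blast
  have \<beta>0: "0 \<le> \<beta>" by (rule lipschitz_on_nonneg[OF lip'])
  have right: "((\<lambda>y. (h y - h x) / (y - x)) \<longlongrightarrow> h' x) (at_right x)" if "0 \<le> x" for x
  proof -
    have "(h has_real_derivative h' x) (at x within {x..})"
      by (rule DERIV_subset[OF der[OF that]]) (use that in auto)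
    then show ?thesis by (simp add: has_field_derivative_iff at_within_Ici_at_right)
  qed
  have bd: "\<bar>h' x\<bar> \<le> \<alpha>" if "0 \<le> x" for x
  proof (rule tendsto_upperbound[OF tendsto_rabs[OF right[OF that]]])
    have "\<bar>(h y - h x) / (y - x)\<bar> \<le> \<alpha>" if "x < y" for y
      using lipschitz_onD[OF lip, of y x] that \<open>0 \<le> x\<close> by (auto simp: dist_real_def field_simps)
    then show "\<forall>\<^sub>F y in at_right x. \<bar>(h y - h x) / (y - x)\<bar> \<le> \<alpha>"
      by (auto simp: eventually_at_filter)
  qed simp
  define g where "g x = (if 0 \<le> x then h x else h 0 + h' 0 * x)" for x
  define g' where "g' x = h' (max x 0)" for x
  have "has_lipschitz_deriv \<alpha> \<beta> g g'"
    unfolding has_lipschitz_deriv_def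
  proof (intro conjI allI)
    fix x y :: real
    show "\<bar>g' x\<bar> \<le> \<alpha>" unfolding g'_def by (rule bd) simp
    have "\<bar>g' x - g' y\<bar> \<le> \<beta> * \<bar>max x 0 - max y 0\<bar>"
      using lipschitz_onD[OF lip', of "max x 0" "max y 0"] by (simp add: g'_def dist_real_def)
    also have "\<dots> \<le> \<beta> * \<bar>x - y\<bar>" by (intro mult_left_mono \<beta>0) auto
    finally show "\<bar>g' x - g' y\<bar> \<le> \<beta> * \<bar>x - y\<bar>" .
    consider "x > 0" | "x < 0" | "x = 0" by linarith
    then show "(g has_real_derivative g' x) (at x)"
    proof cases
      case 1
      have "(h has_real_derivative h' x) (at x within {0<..})"
        by (rule DERIV_subset[OF der]) (use 1 in auto)
      then have "(h has_real_derivative h' x) (at x)"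
        using 1 by (simp add: at_within_open[OF _ open_greaterThan])
      then have "(h has_real_derivative g' x) (at x)" using 1 by (simp add: g'_def)
      then show ?thesis
        by (rule has_field_derivative_transform_within_open[of _ _ _ "{0<..}"])
           (use 1 in \<open>auto simp: g_def\<close>)
    next
      case 2
      have "((\<lambda>x. h 0 + h' 0 * x) has_real_derivative g' x) (at x)"
        using 2 by (auto intro!: derivative_eq_intros simp: g'_def max_def)
      then show ?thesis
        by (rule has_field_derivative_transform_within_open[of _ _ _ "{..<0}"])
           (use 2 in \<open>auto simp: g_def\<close>)
    next
      case 3
      have "((\<lambda>y. (g y - g 0) / (y - 0)) \<longlongrightarrow> h' 0) (at_right 0)"
        by (rule Lim_transform_eventually[OF right[of 0]])
           (auto simp: eventually_at_filter g_def)
      moreover have "((\<lambda>y. (g y - g 0) / (y - 0)) \<longlongrightarrow> h' 0) (at_left 0)"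
        by (rule Lim_transform_eventually[OF tendsto_const])
           (auto simp: eventually_at_filter g_def)
      ultimately show ?thesis
        unfolding 3 has_field_derivative_iff g'_def by (simp add: filterlim_at_split)
    qed
  qed
  then show thesis by (rule that) (simp add: g_def)
qed

section \<open>Averaging over random dilations\<close>

text \<open>
  A remainder that is quadratic uniformly in \<open>y\<close> survives integration over a parameter, so this
  criterion takes the place of differentiation under the integral sign.
\<close>
lemma has_real_derivative_quadratic_error:
  fixes f :: "real \<Rightarrow> real"
  assumes "\<And>y. \<bar>f y - f x - d * (y - x)\<bar> \<le> C * (y - x)\<^sup>2"
  shows "(f has_real_derivative d) (at x)"
proof -
  have "((\<lambda>y. (f y - f x) / (y - x) - d) \<longlongrightarrow> 0) (at x)"
  proof (rule Lim_null_comparison)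
    show "\<forall>\<^sub>F y in at x. norm ((f y - f x) / (y - x) - d) \<le> C * \<bar>y - x\<bar>"
    proof (rule eventually_at_filter[THEN iffD2], intro always_eventually allI impI)
      fix y assume "y \<noteq> x"
      then have "(f y - f x) / (y - x) - d = (f y - f x - d * (y - x)) / (y - x)"
        by (simp add: field_simps)
      also have "norm \<dots> \<le> C * (y - x)\<^sup>2 / \<bar>y - x\<bar>"
        using assms[of y] by (simp add: divide_right_mono)
      also have "\<dots> = C * \<bar>y - x\<bar>"
        using \<open>y \<noteq> x\<close> by (simp add: power2_eq_square field_simps flip: abs_mult)
      finally show "norm ((f y - f x) / (y - x) - d) \<le> C * \<bar>y - x\<bar>" .
    qed
    show "((\<lambda>y. C * \<bar>y - x\<bar>) \<longlongrightarrow> 0) (at x)"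
      by (auto intro!: tendsto_eq_intros)
  qed
  then show ?thesis
    using LIM_zero_iff unfolding has_field_derivative_iff by blast
qed

lemma abs_integral_le_AE:
  fixes f g :: "'a \<Rightarrow> real"
  assumes "integrable M f" "integrable M g" "AE x in M. \<bar>f x\<bar> \<le> g x"
  shows "\<bar>integral\<^sup>L M f\<bar> \<le> integral\<^sup>L M g"
  using integral_abs_bound[of M f] integral_mono_AE[OF integrable_abs[OF assms(1)] assms(2,3)]
  by linarith

lemma (in prob_space) has_lipschitz_deriv_integrable:
  assumes "has_lipschitz_deriv a b g g'" "integrable M X"
  shows "integrable M (\<lambda>\<omega>. g (X \<omega>))"
proof (rule Bochner_Integration.integrable_bound)
  show "integrable M (\<lambda>\<omega>. \<bar>g 0\<bar> + a * \<bar>X \<omega>\<bar>)" using assms(2) by auto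
  show "AE \<omega> in M. norm (g (X \<omega>)) \<le> norm (\<bar>g 0\<bar> + a * \<bar>X \<omega>\<bar>)"
    using has_lipschitz_deriv_growth[OF assms(1)] order.trans[OF _ abs_ge_self]
    by (intro AE_I2) (auto simp del: abs_ge_self)
  have [measurable]: "random_variable borel X" using assms(2) by auto
  note [measurable] = has_lipschitz_deriv_measurable[OF assms(1)]
  show "(\<lambda>\<omega>. g (X \<omega>)) \<in> borel_measurable M" by measurable
qed

lemma (in prob_space) integrable_dilation:
  assumes "has_lipschitz_deriv a b g g'"
    and V: "random_variable borel V" "AE \<omega> in M. 0 \<le> V \<omega> \<and> V \<omega> \<le> 1"
  shows "integrable M (\<lambda>\<omega>. g (V \<omega> * x))" "integrable M (\<lambda>\<omega>. V \<omega> * g' (V \<omega> * x))"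
proof -
  note [measurable] = V(1) has_lipschitz_deriv_measurable[OF assms(1)]
  note a0 = has_lipschitz_deriv_nonneg(1)[OF assms(1)]
  show "integrable M (\<lambda>\<omega>. g (V \<omega> * x))"
  proof (rule integrable_const_bound)
    show "AE \<omega> in M. norm (g (V \<omega> * x)) \<le> \<bar>g 0\<bar> + a * \<bar>x\<bar>"
      using V(2)
    proof eventually_elim
      case (elim \<omega>)
      have "\<bar>g (V \<omega> * x)\<bar> \<le> \<bar>g 0\<bar> + a * (V \<omega> * \<bar>x\<bar>)"
        using has_lipschitz_deriv_growth[OF assms(1), of "V \<omega> * x"] elim by (simp add: abs_mult)
      also have "a * (V \<omega> * \<bar>x\<bar>) \<le> a * \<bar>x\<bar>"
        using elim a0 by (intro mult_left_mono) (auto intro: mult_left_le_one_le)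
      finally show ?case by simp
    qed
  qed simp
  show "integrable M (\<lambda>\<omega>. V \<omega> * g' (V \<omega> * x))"
  proof (rule integrable_const_bound)
    show "AE \<omega> in M. norm (V \<omega> * g' (V \<omega> * x)) \<le> 1 * a"
      using V(2)
    proof eventually_elim
      case (elim \<omega>)
      then show ?case
        unfolding norm_mult
        by (intro mult_mono) (use has_lipschitz_derivD(2)[OF assms(1)] in auto)
    qed
  qed simp
qed

text \<open>
  Differentiating \<open>E g(Vx)\<close> in \<open>x\<close> brings out one factor \<open>V\<close>, and comparing the derivatives at two
  points brings out a second one. Hence the first constant contracts by \<open>E V\<close> and the second
  by \<open>E V\<^sup>2\<close>.
\<close>
lemma (in prob_space) has_lipschitz_deriv_dilation_average:
  assumes g: "has_lipschitz_deriv a b g g'"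
    and V: "random_variable borel V" "AE \<omega> in M. 0 \<le> V \<omega> \<and> V \<omega> \<le> 1"
  shows "has_lipschitz_deriv (a * expectation V) (b * expectation (\<lambda>\<omega>. (V \<omega>)\<^sup>2))
           (\<lambda>x. expectation (\<lambda>\<omega>. g (V \<omega> * x))) (\<lambda>x. expectation (\<lambda>\<omega>. V \<omega> * g' (V \<omega> * x)))"
proof -
  note [measurable] = V(1) has_lipschitz_deriv_measurable[OF g]
  note int = integrable_dilation[OF g V]
  note ab0 = has_lipschitz_deriv_nonneg[OF g]
  have iV: "integrable M V"
    by (rule integrable_const_bound[of _ 1]) (use V in auto)
  have iV2: "integrable M (\<lambda>\<omega>. (V \<omega>)\<^sup>2)"
    by (rule integrable_const_bound[of _ 1]) (auto intro!: eventually_mono[OF V(2)] simp: power_le_one simp del: eventually_conj_iff)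
  show ?thesis
    unfolding has_lipschitz_deriv_def
  proof (intro conjI allI)
    fix x
    show "((\<lambda>x. expectation (\<lambda>\<omega>. g (V \<omega> * x))) has_real_derivative
              expectation (\<lambda>\<omega>. V \<omega> * g' (V \<omega> * x))) (at x)"
    proof (rule has_real_derivative_quadratic_error)
      fix y
      have "expectation (\<lambda>\<omega>. g (V \<omega> * y)) - expectation (\<lambda>\<omega>. g (V \<omega> * x))
              - expectation (\<lambda>\<omega>. V \<omega> * g' (V \<omega> * x)) * (y - x)
            = expectation (\<lambda>\<omega>. g (V \<omega> * y) - g (V \<omega> * x) - V \<omega> * g' (V \<omega> * x) * (y - x))"
        using int by simp
      also have "\<bar>\<dots>\<bar> \<le> expectation (\<lambda>\<omega>. b / 2 * (y - x)\<^sup>2)"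
      proof (rule abs_integral_le_AE)
        show "AE \<omega> in M. \<bar>g (V \<omega> * y) - g (V \<omega> * x) - V \<omega> * g' (V \<omega> * x) * (y - x)\<bar>
                \<le> b / 2 * (y - x)\<^sup>2"
          using V(2)
        proof eventually_elim
          case (elim \<omega>)
          have "\<bar>g (V \<omega> * y) - g (V \<omega> * x) - g' (V \<omega> * x) * (V \<omega> * y - V \<omega> * x)\<bar>
                  \<le> b / 2 * (V \<omega> * y - V \<omega> * x)\<^sup>2"
            by (rule has_lipschitz_deriv_taylor[OF g])
          also have "\<dots> = b / 2 * ((V \<omega>)\<^sup>2 * (y - x)\<^sup>2)"
            by (simp add: power2_eq_square algebra_simps)
          also have "\<dots> \<le> b / 2 * (1 * (y - x)\<^sup>2)"
            using elim ab0 by (intro mult_left_mono mult_right_mono) (auto simp: power_le_one)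
          finally show ?case by (simp add: algebra_simps)
        qed
      qed (use int in auto)
      also have "\<dots> = b / 2 * (y - x)\<^sup>2" by (simp add: prob_space)
      finally show "\<bar>expectation (\<lambda>\<omega>. g (V \<omega> * y)) - expectation (\<lambda>\<omega>. g (V \<omega> * x))
              - expectation (\<lambda>\<omega>. V \<omega> * g' (V \<omega> * x)) * (y - x)\<bar> \<le> b / 2 * (y - x)\<^sup>2" .
    qed
  next
    fix x
    have "\<bar>expectation (\<lambda>\<omega>. V \<omega> * g' (V \<omega> * x))\<bar> \<le> expectation (\<lambda>\<omega>. a * V \<omega>)"
    proof (rule abs_integral_le_AE)
      show "AE \<omega> in M. \<bar>V \<omega> * g' (V \<omega> * x)\<bar> \<le> a * V \<omega>"
        using V(2)
      proof eventually_elim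
        case (elim \<omega>)
        then show ?case
          using mult_left_mono[OF has_lipschitz_derivD(2)[OF g, of "V \<omega> * x"], of "V \<omega>"]
          by (simp add: abs_mult mult.commute)
      qed
    qed (use int iV in auto)
    then show "\<bar>expectation (\<lambda>\<omega>. V \<omega> * g' (V \<omega> * x))\<bar> \<le> a * expectation V" by simp
  next
    fix x y
    have "\<bar>expectation (\<lambda>\<omega>. V \<omega> * g' (V \<omega> * x)) - expectation (\<lambda>\<omega>. V \<omega> * g' (V \<omega> * y))\<bar>
            = \<bar>expectation (\<lambda>\<omega>. V \<omega> * g' (V \<omega> * x) - V \<omega> * g' (V \<omega> * y))\<bar>"
      using int by simp
    also have "\<dots> \<le> expectation (\<lambda>\<omega>. b * (V \<omega>)\<^sup>2 * \<bar>x - y\<bar>)"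
    proof (rule abs_integral_le_AE)
      show "AE \<omega> in M. \<bar>V \<omega> * g' (V \<omega> * x) - V \<omega> * g' (V \<omega> * y)\<bar> \<le> b * (V \<omega>)\<^sup>2 * \<bar>x - y\<bar>"
        using V(2)
      proof eventually_elim
        case (elim \<omega>)
        have "\<bar>V \<omega> * g' (V \<omega> * x) - V \<omega> * g' (V \<omega> * y)\<bar>
                = V \<omega> * \<bar>g' (V \<omega> * x) - g' (V \<omega> * y)\<bar>"
          using elim by (simp add: abs_mult flip: right_diff_distrib)
        also have "\<dots> \<le> V \<omega> * (b * \<bar>V \<omega> * x - V \<omega> * y\<bar>)"
          using elim by (intro mult_left_mono has_lipschitz_derivD(3)[OF g]) auto
        also have "\<bar>V \<omega> * x - V \<omega> * y\<bar> = V \<omega> * \<bar>x - y\<bar>"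
          using elim by (simp add: abs_mult flip: right_diff_distrib)
        finally show ?case by (simp add: power2_eq_square algebra_simps)
      qed
    qed (use int iV2 in auto)
    finally show "\<bar>expectation (\<lambda>\<omega>. V \<omega> * g' (V \<omega> * x)) - expectation (\<lambda>\<omega>. V \<omega> * g' (V \<omega> * y))\<bar>
                    \<le> b * expectation (\<lambda>\<omega>. (V \<omega>)\<^sup>2) * \<bar>x - y\<bar>"
      by simp
  qed
qed

abbreviation unif :: "real measure" where
  "unif \<equiv> uniform_measure lborel {0..1}"

lemma prob_space_unif: "prob_space unif"
  by (rule prob_space_uniform_measure) auto

interpretation unif: prob_space unif
  by (rule prob_space_unif)

lemma AE_unif: "AE u in unif. 0 \<le> u \<and> u \<le> 1"
  by (rule AE_uniform_measureI) auto

lemma unif_integral_eq: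
  fixes f :: "real \<Rightarrow> real"
  assumes [measurable]: "f \<in> borel_measurable borel" and cont: "continuous_on {0..1} f"
  shows "integral\<^sup>L unif f = integral {0..1} f"
proof -
  have "unif = density lborel (\<lambda>x. ennreal (indicator {0..1} x))"
    by (simp add: uniform_measure_def divide_ennreal_def ennreal_indicator)
  then have "integral\<^sup>L unif f = (LINT x:{0..1}|lborel. f x)"
    by (simp add: integral_density set_lebesgue_integral_def)
  also have "\<dots> = integral {0..1} f"
    by (rule set_borel_integral_eq_integral)
       (use borel_integrable_atLeastAtMost'[OF cont] in \<open>simp add: set_integrable_def\<close>)
  finally show ?thesis .
qed

lemma expectation_unif_powr:
  fixes c :: real
  assumes "0 < c"
  shows "(\<integral>u. u powr c \<partial>unif) = 1 / (c + 1)"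
proof -
  have "((\<lambda>x. x powr c) has_integral (1 powr (c + 1) / (c + 1))) {0..1::real}"
    by (rule has_integral_powr_from_0) (use assms in auto)
  moreover have "continuous_on {0..1::real} (\<lambda>x. x powr c)"
    by (intro continuous_on_powr' continuous_intros) (use assms in auto)
  ultimately show ?thesis
    by (subst unif_integral_eq) (auto dest: integral_unique)
qed

lemma unif_powr_bounds:
  assumes "0 < (\<theta> :: real)"
  shows "AE u in unif. 0 \<le> u powr (1 / \<theta>) \<and> u powr (1 / \<theta>) \<le> 1"
  using assms by (auto intro!: eventually_mono[OF AE_unif] simp: powr_le1 simp del: eventually_conj_iff)

lemma integrable_unif_powr:
  assumes "0 < (\<theta> :: real)"
  shows "integrable unif (\<lambda>u. u powr (1 / \<theta>))"
  by (rule unif.integrable_const_bound[of _ 1]) (use unif_powr_bounds[OF assms] in auto)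

text \<open>
  The integrand of the left-hand side is the derivative of \<open>u \<mapsto> u g(u\<^sup>1\<^sup>/\<^sup>\<theta> x)\<close>, which is \<open>0\<close> at \<open>0\<close> and
  \<open>g(x)\<close> at \<open>1\<close>.
\<close>
lemma averaging_ode:
  assumes "0 < \<theta>" and g: "has_lipschitz_deriv a b g g'"
  shows "x / \<theta> * (\<integral>u. u powr (1 / \<theta>) * g' (u powr (1 / \<theta>) * x) \<partial>unif)
           + (\<integral>u. g (u powr (1 / \<theta>) * x) \<partial>unif) = g x"
proof -
  note [measurable] = has_lipschitz_deriv_measurable[OF g]
  note int = unif.integrable_dilation[OF g _ unif_powr_bounds[OF assms(1)]]
  have cp: "continuous_on {0..1} (\<lambda>u::real. u powr (1 / \<theta>))"
    by (intro continuous_on_powr' continuous_intros) (use assms in auto)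
  define F where "F u = x / \<theta> * (u powr (1 / \<theta>) * g' (u powr (1 / \<theta>) * x))
                          + g (u powr (1 / \<theta>) * x)" for u
  have "(F has_integral (1 * g (1 powr (1 / \<theta>) * x) - 0 * g (0 powr (1 / \<theta>) * x))) {0..1}"
  proof (rule fundamental_theorem_of_calculus_interior[where f = "\<lambda>u. u * g (u powr (1 / \<theta>) * x)"])
    show "continuous_on {0..1} (\<lambda>u. u * g (u powr (1 / \<theta>) * x))"
      by (intro continuous_intros cp continuous_on_compose2[OF has_lipschitz_deriv_continuous(1)[OF g, of UNIV]]) auto
    fix u :: real assume u: "u \<in> {0<..<1}"
    have "((\<lambda>u. u powr (1 / \<theta>) * x) has_real_derivative 1 / \<theta> * u powr (1 / \<theta> - 1) * x) (at u)"
      using u by (auto intro!: derivative_eq_intros)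
    then have "((\<lambda>u. u * g (u powr (1 / \<theta>) * x)) has_real_derivative
        u * (g' (u powr (1 / \<theta>) * x) * (1 / \<theta> * u powr (1 / \<theta> - 1) * x)) + 1 * g (u powr (1 / \<theta>) * x)) (at u)"
      using DERIV_chain2[OF has_lipschitz_derivD(1)[OF g]]
      by (auto intro!: derivative_eq_intros)
    also have "u * (g' (u powr (1 / \<theta>) * x) * (1 / \<theta> * u powr (1 / \<theta> - 1) * x)) + 1 * g (u powr (1 / \<theta>) * x) = F u"
      using u by (simp add: F_def powr_diff)
    finally show "((\<lambda>u. u * g (u powr (1 / \<theta>) * x)) has_vector_derivative F u) (at u)"
      by (simp add: has_real_derivative_iff_has_vector_derivative)
  qed simp
  then have "integral {0..1} F = g x" by (simp add: integral_unique)
  moreover have "continuous_on {0..1} F"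
    unfolding F_def
    by (intro continuous_intros cp continuous_on_compose2[OF has_lipschitz_deriv_continuous(1)[OF g, of UNIV]]
         continuous_on_compose2[OF has_lipschitz_deriv_continuous(2)[OF g, of UNIV]]) auto
  moreover have "F \<in> borel_measurable borel" unfolding F_def by measurable
  ultimately have "integral\<^sup>L unif F = g x" by (simp add: unif_integral_eq)
  then show ?thesis using int unfolding F_def by simp
qed

section \<open>The generalized Dickman law\<close>

text \<open>
  The fixed point equation in integrated form: the map \<open>f \<mapsto> (w \<mapsto> Af(w + 1))\<close> preserves means under
  the Dickman law.
\<close>
lemma generalized_dickman_integral:
  assumes D: "generalized_dickman \<theta> D" and [measurable]: "f \<in> borel_measurable borel"
    and int: "integrable D f"
  shows "integrable D (\<lambda>w. \<integral>u. f (u powr (1 / \<theta>) * (w + 1)) \<partial>unif)"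
    and "(\<integral>w. (\<integral>u. f (u powr (1 / \<theta>) * (w + 1)) \<partial>unif) \<partial>D) = (\<integral>w. (f w :: real) \<partial>D)"
proof -
  have ps: "prob_space D" and [measurable_cong]: "sets D = sets borel"
    and eq: "D = distr (unif \<Otimes>\<^sub>M D) borel (\<lambda>(u, w). u powr (1 / \<theta>) * (w + 1))"
    using D unfolding generalized_dickman_def by blast+
  interpret D: prob_space D by (rule ps)
  interpret pair_sigma_finite unif D ..
  have [measurable]: "(\<lambda>(u, w). u powr (1 / \<theta>) * (w + 1)) \<in> borel_measurable (unif \<Otimes>\<^sub>M D)"
    by measurable
  have "integrable (distr (unif \<Otimes>\<^sub>M D) borel (\<lambda>(u, w). u powr (1 / \<theta>) * (w + 1))) f"
    using int eq by simp
  then have int2: "integrable (unif \<Otimes>\<^sub>M D) (\<lambda>(u, w). f (u powr (1 / \<theta>) * (w + 1)))"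
    by (simp add: integrable_distr_eq case_prod_beta')
  show "integrable D (\<lambda>w. \<integral>u. f (u powr (1 / \<theta>) * (w + 1)) \<partial>unif)"
    by (rule integrable_snd[OF int2])
  have "(\<integral>w. (\<integral>u. f (u powr (1 / \<theta>) * (w + 1)) \<partial>unif) \<partial>D)
          = integral\<^sup>L (unif \<Otimes>\<^sub>M D) (\<lambda>(u, w). f (u powr (1 / \<theta>) * (w + 1)))"
    by (rule integral_snd[OF int2])
  also have "\<dots> = integral\<^sup>L (distr (unif \<Otimes>\<^sub>M D) borel (\<lambda>(u, w). u powr (1 / \<theta>) * (w + 1))) f"
    by (simp add: integral_distr case_prod_beta')
  also have "\<dots> = integral\<^sup>L D f" using eq by simp
  finally show "(\<integral>w. (\<integral>u. f (u powr (1 / \<theta>) * (w + 1)) \<partial>unif) \<partial>D) = (\<integral>w. f w \<partial>D)" .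
qed

text \<open>
  Taking means in the fixed point equation says nothing while the mean may be infinite. Applied
  to the bounded functions \<open>min K (a |w| + b)\<close>, the equation gives an inequality by Jensen (the minimum is concave) in which \<open>a\<close> shrinks to \<open>a \<rho>\<close> and \<open>b\<close> grows
  to \<open>b + a \<rho>\<close>, where \<open>\<rho> = \<theta>/(\<theta>+1)\<close>. Starting from \<open>a = 1\<close>, \<open>b = 0\<close> and iterating, \<open>a\<close> tends to \<open>0\<close> while \<open>b\<close>
  stays below \<open>\<rho>/(1-\<rho>) = \<theta>\<close>. So all truncated means are at most \<open>\<theta>\<close>, uniformly in \<open>K\<close>.
\<close>
lemma generalized_dickman_integrable:
  assumes "0 < \<theta>" and D: "generalized_dickman \<theta> D"
  shows "integrable D (\<lambda>w. w)"
proof -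
  have ps: "prob_space D" and [measurable_cong]: "sets D = sets borel"
    using D unfolding generalized_dickman_def by blast+
  interpret D: prob_space D by (rule ps)
  define \<rho> where "\<rho> = \<theta> / (\<theta> + 1)"
  have \<rho>: "0 < \<rho>" "\<rho> < 1" using assms(1) by (auto simp: \<rho>_def)
  have "\<rho> * (\<theta> + 1) = \<theta>" using assms(1) by (simp add: \<rho>_def)
  then have \<rho>\<theta>: "\<rho> + \<theta> * \<rho> = \<theta>" by (simp add: algebra_simps)
  have E\<rho>: "(\<integral>u. u powr (1 / \<theta>) \<partial>unif) = \<rho>"
    using assms(1) expectation_unif_powr[of "1 / \<theta>"] by (simp add: \<rho>_def field_simps)
  have trunc: "D.expectation (\<lambda>w. min K \<bar>w\<bar>) \<le> \<theta>" if K: "0 \<le> K" for K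
  proof -
    have int: "integrable D (\<lambda>w. min K (a * \<bar>w\<bar> + b))" if "0 \<le> a" "0 \<le> b" for a b
      by (rule D.integrable_const_bound[of _ K]) (use that K in auto)
    have step: "D.expectation (\<lambda>w. min K (a * \<bar>w\<bar> + b))
                  \<le> D.expectation (\<lambda>w. min K (a * \<rho> * \<bar>w\<bar> + (a * \<rho> + b)))"
      if ab: "0 \<le> a" "0 \<le> b" for a b
    proof -
      have "D.expectation (\<lambda>w. min K (a * \<bar>w\<bar> + b))
          = D.expectation (\<lambda>w. \<integral>u. min K (a * \<bar>u powr (1 / \<theta>) * (w + 1)\<bar> + b) \<partial>unif)"
        by (rule generalized_dickman_integral(2)[OF D, symmetric]) (use int[OF ab] in auto)
      also have "\<dots> \<le> D.expectation (\<lambda>w. min K (a * \<rho> * \<bar>w\<bar> + (a * \<rho> + b)))"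
      proof (rule integral_mono)
        show "integrable D (\<lambda>w. \<integral>u. min K (a * \<bar>u powr (1 / \<theta>) * (w + 1)\<bar> + b) \<partial>unif)"
          by (rule generalized_dickman_integral(1)[OF D]) (use int[OF ab] in auto)
        show "integrable D (\<lambda>w. min K (a * \<rho> * \<bar>w\<bar> + (a * \<rho> + b)))"
          by (rule int) (use ab \<rho> in auto)
        fix w
        have i1: "integrable unif (\<lambda>u. min K (a * \<bar>u powr (1 / \<theta>) * (w + 1)\<bar> + b))"
          by (rule unif.integrable_const_bound[of _ K]) (use ab K in auto)
        have "(\<integral>u. min K (a * \<bar>u powr (1 / \<theta>) * (w + 1)\<bar> + b) \<partial>unif) \<le> (\<integral>u. K \<partial>unif)"
          by (rule integral_mono[OF i1]) auto
        then have "(\<integral>u. min K (a * \<bar>u powr (1 / \<theta>) * (w + 1)\<bar> + b) \<partial>unif) \<le> K"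
          using unif.prob_space by simp
        moreover have "(\<integral>u. min K (a * \<bar>u powr (1 / \<theta>) * (w + 1)\<bar> + b) \<partial>unif)
            \<le> (\<integral>u. a * (\<bar>w\<bar> + 1) * u powr (1 / \<theta>) + b \<partial>unif)"
        proof (rule integral_mono[OF i1])
          show "integrable unif (\<lambda>u. a * (\<bar>w\<bar> + 1) * u powr (1 / \<theta>) + b)"
            using integrable_unif_powr[OF assms(1)] by simp
          fix u :: real
          have "a * (u powr (1 / \<theta>) * \<bar>w + 1\<bar>) \<le> a * (u powr (1 / \<theta>) * (\<bar>w\<bar> + 1))"
            by (intro mult_left_mono) (use ab in auto)
          then show "min K (a * \<bar>u powr (1 / \<theta>) * (w + 1)\<bar> + b) \<le> a * (\<bar>w\<bar> + 1) * u powr (1 / \<theta>) + b"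
            by (simp add: abs_mult mult_ac)
        qed
        moreover have "(\<integral>u. a * (\<bar>w\<bar> + 1) * u powr (1 / \<theta>) + b \<partial>unif) = a * \<rho> * \<bar>w\<bar> + (a * \<rho> + b)"
          using integrable_unif_powr[OF assms(1)] unif.prob_space E\<rho> by (simp add: algebra_simps)
        ultimately show "(\<integral>u. min K (a * \<bar>u powr (1 / \<theta>) * (w + 1)\<bar> + b) \<partial>unif)
                           \<le> min K (a * \<rho> * \<bar>w\<bar> + (a * \<rho> + b))"
          by simp
      qed
      finally show ?thesis .
    qed
    have iter: "D.expectation (\<lambda>w. min K \<bar>w\<bar>)
                  \<le> D.expectation (\<lambda>w. min K (\<rho> ^ m * \<bar>w\<bar> + \<theta> * (1 - \<rho> ^ m)))" for m
    proof (induction m)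
      case (Suc m)
      have "\<rho> ^ m \<le> 1" using \<rho> by (simp add: power_le_one)
      moreover have "\<rho> ^ m * \<rho> + \<theta> * (1 - \<rho> ^ m) = \<theta> * (1 - \<rho> ^ Suc m)"
      proof -
        have "\<rho> ^ m * (\<rho> + \<theta> * \<rho>) = \<rho> ^ m * \<theta>" using \<rho>\<theta> by simp
        then show ?thesis by (simp add: algebra_simps)
      qed
      ultimately show ?case
        using Suc step[of "\<rho> ^ m" "\<theta> * (1 - \<rho> ^ m)"] \<rho> assms(1) by (simp add: mult.commute)
    qed simp
    have "(\<lambda>m. D.expectation (\<lambda>w. min K (\<rho> ^ m * \<bar>w\<bar> + \<theta> * (1 - \<rho> ^ m))))
            \<longlonglongrightarrow> D.expectation (\<lambda>w. min K \<theta>)"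
    proof (rule integral_dominated_convergence[where w = "\<lambda>_. K"])
      have "(\<lambda>m. min K (\<rho> ^ m * \<bar>w\<bar> + \<theta> * (1 - \<rho> ^ m))) \<longlonglongrightarrow> min K (0 * \<bar>w\<bar> + \<theta> * (1 - 0))" for w
        by (intro tendsto_intros LIMSEQ_realpow_zero) (use \<rho> in auto)
      then show "AE w in D. (\<lambda>m. min K (\<rho> ^ m * \<bar>w\<bar> + \<theta> * (1 - \<rho> ^ m))) \<longlonglongrightarrow> min K \<theta>"
        by simp
      have "\<rho> ^ m \<le> 1" for m using \<rho> by (simp add: power_le_one)
      then show "AE w in D. norm (min K (\<rho> ^ m * \<bar>w\<bar> + \<theta> * (1 - \<rho> ^ m))) \<le> K" for m
        using K \<rho> assms(1) by auto
    qed auto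
    then have "D.expectation (\<lambda>w. min K \<bar>w\<bar>) \<le> D.expectation (\<lambda>w. min K \<theta>)"
      by (rule LIMSEQ_le_const) (use iter in auto)
    also have "\<dots> \<le> \<theta>" by (simp add: D.prob_space)
    finally show ?thesis .
  qed
  have "(\<integral>\<^sup>+w. ennreal \<bar>w\<bar> \<partial>D) \<le> ennreal \<theta>"
  proof (rule LIMSEQ_le_const2)
    show "(\<lambda>i. \<integral>\<^sup>+w. ennreal (min (real i) \<bar>w\<bar>) \<partial>D) \<longlonglongrightarrow> (\<integral>\<^sup>+w. ennreal \<bar>w\<bar> \<partial>D)"
    proof (rule nn_integral_LIMSEQ)
      show "incseq (\<lambda>i w. ennreal (min (real i) \<bar>w\<bar>))"
        by (auto simp: incseq_def le_fun_def intro!: ennreal_leI)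
      fix w :: real
      have "\<forall>\<^sub>F i in sequentially. ennreal \<bar>w\<bar> = ennreal (min (real i) \<bar>w\<bar>)"
        using eventually_ge_at_top[of "nat \<lceil>\<bar>w\<bar>\<rceil>"]
        by eventually_elim (auto simp: min_def nat_le_iff ceiling_le_iff)
      then show "(\<lambda>i. ennreal (min (real i) \<bar>w\<bar>)) \<longlonglongrightarrow> ennreal \<bar>w\<bar>"
        by (rule Lim_transform_eventually[OF tendsto_const])
    qed simp
    have "(\<integral>\<^sup>+w. ennreal (min (real i) \<bar>w\<bar>) \<partial>D) = ennreal (D.expectation (\<lambda>w. min (real i) \<bar>w\<bar>))" for i
      by (rule nn_integral_eq_integral) (auto intro!: D.integrable_const_bound[of _ "real i"])
    then show "\<exists>N. \<forall>i\<ge>N. (\<integral>\<^sup>+w. ennreal (min (real i) \<bar>w\<bar>) \<partial>D) \<le> ennreal \<theta>"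
      using trunc by (auto intro!: ennreal_leI)
  qed
  then show ?thesis
    by (intro integrableI_bounded) (auto simp: le_less_trans)
qed

section \<open>Approximate solutions of the Stein equation\<close>

text \<open>
  Induction on the number \<open>m\<close> of terms of \<open>f = \<Sum>k<m. Ah\<^sub>k\<close>: with \<open>q = Ar\<close>, adding \<open>q\<close> to \<open>f\<close> replaces the
  remainder \<open>r\<close> by \<open>x \<mapsto> q(x + 1)\<close>, because \<open>(x/\<theta>) q' + q = r\<close>. The constants for \<open>f\<close> are partial sums of the
  geometric series with ratios \<open>\<rho>\<close> and \<open>\<rho>2\<close>, and the closed forms below use
  \<open>\<rho>/(1-\<rho>) = \<theta>\<close> and \<open>\<rho>2/(1-\<rho>2) = \<theta>/2\<close>.
\<close>
lemma truncated_dickman_stein_solution: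
  fixes \<theta> a b :: real and m :: nat
  defines "\<rho> \<equiv> \<theta> / (\<theta> + 1)" and "\<rho>2 \<equiv> \<theta> / (\<theta> + 2)"
  assumes \<theta>: "0 < \<theta>" and D: "generalized_dickman \<theta> D" and g: "has_lipschitz_deriv a b g g'"
  shows "\<exists>f f' r r'. has_lipschitz_deriv (a * \<theta> * (1 - \<rho> ^ m)) (b * (\<theta> / 2) * (1 - \<rho>2 ^ m)) f f' \<and>
           has_lipschitz_deriv (a * \<rho> ^ m) (b * \<rho>2 ^ m) r r' \<and>
           (\<forall>x. x / \<theta> * f' x + f x - f (x + 1) = g x - r x) \<and>
           (\<integral>w. r w \<partial>D) = (\<integral>w. g w \<partial>D)"
proof (induction m)
  case 0
  have "has_lipschitz_deriv 0 0 (\<lambda>_. 0) (\<lambda>_. 0)" by (simp add: has_lipschitz_deriv_def)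
  then show ?case
    by (intro exI[of _ "\<lambda>_. 0"] exI[of _ g] exI[of _ g']) (use g in simp)
next
  case (Suc m)
  then obtain f f' r r' where f: "has_lipschitz_deriv (a * \<theta> * (1 - \<rho> ^ m)) (b * (\<theta> / 2) * (1 - \<rho>2 ^ m)) f f'"
    and r: "has_lipschitz_deriv (a * \<rho> ^ m) (b * \<rho>2 ^ m) r r'"
    and eq: "\<And>x. x / \<theta> * f' x + f x - f (x + 1) = g x - r x"
    and mean: "(\<integral>w. r w \<partial>D) = (\<integral>w. g w \<partial>D)"
    by blast
  have sums: "\<rho> * (\<theta> + 1) = \<theta>" "\<rho>2 * (\<theta> + 2) = \<theta>" using \<theta> by (simp_all add: \<rho>_def \<rho>2_def)
  have E1: "(\<integral>u. u powr (1 / \<theta>) \<partial>unif) = \<rho>"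
    using \<theta> expectation_unif_powr[of "1 / \<theta>"] by (simp add: \<rho>_def field_simps)
  have sq: "(\<lambda>u::real. (u powr (1 / \<theta>))\<^sup>2) = (\<lambda>u. u powr (2 / \<theta>))"
    by (auto simp: power2_eq_square simp flip: powr_add)
  have E2: "(\<integral>u. (u powr (1 / \<theta>))\<^sup>2 \<partial>unif) = \<rho>2"
    unfolding sq using \<theta> expectation_unif_powr[of "2 / \<theta>"] by (simp add: \<rho>2_def field_simps)
  define q where "q x = (\<integral>u. r (u powr (1 / \<theta>) * x) \<partial>unif)" for x
  define q' where "q' x = (\<integral>u. u powr (1 / \<theta>) * r' (u powr (1 / \<theta>) * x) \<partial>unif)" for x
  have q: "has_lipschitz_deriv (a * \<rho> ^ Suc m) (b * \<rho>2 ^ Suc m) q q'"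
    using unif.has_lipschitz_deriv_dilation_average[OF r _ unif_powr_bounds[OF \<theta>]]
    unfolding E1 E2 q_def[abs_def] q'_def[abs_def] by (simp add: mult_ac)
  show ?case
  proof (intro exI conjI allI)
    have "a * \<theta> * (1 - \<rho> ^ m) + a * \<rho> ^ Suc m = a * \<theta> * (1 - \<rho> ^ Suc m)"
    proof -
      have "a * \<rho> ^ m * (\<rho> * (\<theta> + 1)) = a * \<rho> ^ m * \<theta>" using sums by simp
      then show ?thesis by (simp add: algebra_simps)
    qed
    moreover have "b * (\<theta> / 2) * (1 - \<rho>2 ^ m) + b * \<rho>2 ^ Suc m = b * (\<theta> / 2) * (1 - \<rho>2 ^ Suc m)"
    proof -
      have "b * \<rho>2 ^ m * (\<rho>2 * (\<theta> + 2)) = b * \<rho>2 ^ m * \<theta>" using sums by simp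
      then show ?thesis by (simp add: field_simps)
    qed
    ultimately show "has_lipschitz_deriv (a * \<theta> * (1 - \<rho> ^ Suc m)) (b * (\<theta> / 2) * (1 - \<rho>2 ^ Suc m))
        (\<lambda>x. f x + q x) (\<lambda>x. f' x + q' x)"
      using has_lipschitz_deriv_add[OF f q] by (simp only:)
    show "has_lipschitz_deriv (a * \<rho> ^ Suc m) (b * \<rho>2 ^ Suc m) (\<lambda>x. q (x + 1)) (\<lambda>x. q' (x + 1))"
      by (rule has_lipschitz_deriv_shift[OF q])
    show "x / \<theta> * (f' x + q' x) + (f x + q x) - (f (x + 1) + q (x + 1)) = g x - q (x + 1)" for x
      using eq[of x] averaging_ode[OF \<theta> r, of x] unfolding q_def[symmetric] q'_def[symmetric]
      by (simp add: algebra_simps)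
    have "prob_space D" using D by (simp add: generalized_dickman_def)
    then have "integrable D (\<lambda>w. r w)"
      by (rule prob_space.has_lipschitz_deriv_integrable[OF _ r generalized_dickman_integrable[OF \<theta> D]])
    from generalized_dickman_integral(2)[OF D has_lipschitz_deriv_measurable(1)[OF r] this]
    show "(\<integral>w. q (w + 1) \<partial>D) = (\<integral>w. g w \<partial>D)" unfolding q_def mean .
  qed
qed

text \<open>
  Under \<open>W\<close>, the test function and its remainder \<open>r\<close> differ in mean by at most \<open>B\<close>; under the Dickman
  law they have the same mean. The remainder has Lipschitz constant \<open>\<rho>\<^sup>m\<close> and is therefore nearly
  constant, so its means under the two laws differ by at most \<open>\<rho>\<^sup>m (E|W| + E|D|)\<close>. Let \<open>m\<close> tend to
  infinity.
\<close>
lemma dickman_distance_from_stein_bound: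
  fixes \<theta> B :: real and W :: "'a \<Rightarrow> real"
  assumes M: "prob_space M" and \<theta>: "0 < \<theta>" and D: "generalized_dickman \<theta> D"
    and W: "integrable M W"
    and stein: "\<And>f F. has_lipschitz_deriv \<theta> (\<theta> / 2) f F \<Longrightarrow>
        \<bar>\<integral>\<omega>. W \<omega> / \<theta> * F (W \<omega>) + f (W \<omega>) - f (W \<omega> + 1) \<partial>M\<bar> \<le> B"
    and g: "has_lipschitz_deriv 1 1 g g'"
  shows "\<bar>(\<integral>w. g w \<partial>D) - (\<integral>\<omega>. g (W \<omega>) \<partial>M)\<bar> \<le> B"
proof -
  interpret prob_space M by (rule M)
  interpret D: prob_space D using D by (simp add: generalized_dickman_def)
  have iD: "integrable D (\<lambda>w. w)" by (rule generalized_dickman_integrable[OF \<theta> D])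
  define \<rho> \<rho>2 where "\<rho> = \<theta> / (\<theta> + 1)" and "\<rho>2 = \<theta> / (\<theta> + 2)"
  have \<rho>: "0 < \<rho>" "\<rho> < 1" "0 < \<rho>2" using \<theta> by (auto simp: \<rho>_def \<rho>2_def)
  define K where "K = expectation (\<lambda>\<omega>. \<bar>W \<omega>\<bar>) + D.expectation (\<lambda>w. \<bar>w\<bar>)"
  have bound: "\<bar>(\<integral>w. g w \<partial>D) - (\<integral>\<omega>. g (W \<omega>) \<partial>M)\<bar> \<le> B + \<rho> ^ m * K" for m
  proof -
    obtain f f' r r' where f: "has_lipschitz_deriv (\<theta> * (1 - \<rho> ^ m)) (\<theta> / 2 * (1 - \<rho>2 ^ m)) f f'"
      and r: "has_lipschitz_deriv (\<rho> ^ m) (\<rho>2 ^ m) r r'"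
      and eq: "\<And>x. x / \<theta> * f' x + f x - f (x + 1) = g x - r x"
      and mean: "(\<integral>w. r w \<partial>D) = (\<integral>w. g w \<partial>D)"
      using truncated_dickman_stein_solution[OF \<theta> D g, of m] unfolding \<rho>_def \<rho>2_def by auto
    have "\<theta> * (1 - \<rho> ^ m) \<le> \<theta>" "\<theta> / 2 * (1 - \<rho>2 ^ m) \<le> \<theta> / 2"
      using \<theta> \<rho> by (auto intro!: mult_left_le)
    from stein[OF has_lipschitz_deriv_mono[OF f this]]
    have 1: "\<bar>expectation (\<lambda>\<omega>. g (W \<omega>)) - expectation (\<lambda>\<omega>. r (W \<omega>))\<bar> \<le> B"
      unfolding eq
      by (subst (asm) Bochner_Integration.integral_diff[OF has_lipschitz_deriv_integrable[OF g W]
              has_lipschitz_deriv_integrable[OF r W]])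
    have "\<bar>expectation (\<lambda>\<omega>. r (W \<omega>) - r 0)\<bar> \<le> expectation (\<lambda>\<omega>. \<rho> ^ m * \<bar>W \<omega>\<bar>)"
      by (rule abs_integral_le_AE)
         (use has_lipschitz_deriv_integrable[OF r W] W has_lipschitz_deriv_lipschitz[OF r, of _ 0] in auto)
    then have 2: "\<bar>expectation (\<lambda>\<omega>. r (W \<omega>)) - r 0\<bar> \<le> \<rho> ^ m * expectation (\<lambda>\<omega>. \<bar>W \<omega>\<bar>)"
      using has_lipschitz_deriv_integrable[OF r W] by (simp add: prob_space)
    have "\<bar>D.expectation (\<lambda>w. r w - r 0)\<bar> \<le> D.expectation (\<lambda>w. \<rho> ^ m * \<bar>w\<bar>)"
      by (rule abs_integral_le_AE)
         (use D.has_lipschitz_deriv_integrable[OF r iD] iD has_lipschitz_deriv_lipschitz[OF r, of _ 0] in auto)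
    then have 3: "\<bar>D.expectation r - r 0\<bar> \<le> \<rho> ^ m * D.expectation (\<lambda>w. \<bar>w\<bar>)"
      using D.has_lipschitz_deriv_integrable[OF r iD] by (simp add: D.prob_space)
    show ?thesis
      using 1 2 3 unfolding mean[symmetric] K_def distrib_left by linarith
  qed
  have "(\<lambda>m. B + \<rho> ^ m * K) \<longlonglongrightarrow> B + 0 * K"
    by (intro tendsto_intros LIMSEQ_realpow_zero) (use \<rho> in auto)
  from LIMSEQ_le_const[OF this] show ?thesis using bound by auto
qed

section \<open>The Poisson identity for a summand of the weighted sum\<close>

text \<open>
  Term by term, since \<open>(k + 1) p(k + 1) = rate * p(k)\<close> for the Poisson weights \<open>p\<close>.
\<close>
lemma poisson_pmf_stein:
  fixes \<phi> :: "nat \<Rightarrow> real"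
  assumes "0 < rate" and bd: "\<And>k. \<bar>\<phi> k\<bar> \<le> C"
  shows "integrable (poisson_pmf rate) (\<lambda>k. real k * \<phi> k)"
    and "(\<integral>k. real k * \<phi> k \<partial>poisson_pmf rate) = rate * (\<integral>k. \<phi> (Suc k) \<partial>poisson_pmf rate)"
proof -
  let ?p = "\<lambda>k. pmf (poisson_pmf rate) k"
  have rec: "?p (Suc k) * real (Suc k) = rate * ?p k" for k
    using assms(1) by (simp add: field_simps del: of_nat_Suc)
  have "integrable (poisson_pmf rate) (\<lambda>k. \<phi> (Suc k))"
    by (rule measure_pmf.integrable_const_bound[of _ C]) (use bd in auto)
  then have i1: "integrable (count_space UNIV) (\<lambda>k. ?p k * \<phi> (Suc k))"
    by (simp add: measure_pmf_eq_density integrable_density)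
  then have "summable (\<lambda>k. rate * norm (?p k * \<phi> (Suc k)))"
    by (intro summable_mult) (simp only: integrable_count_space_nat_iff)
  also have "(\<lambda>k. rate * norm (?p k * \<phi> (Suc k))) = (\<lambda>k. norm (?p (Suc k) * (real (Suc k) * \<phi> (Suc k))))"
    (is "?l = ?r")
  proof
    fix k
    have "?r k = \<bar>(?p (Suc k) * real (Suc k)) * \<phi> (Suc k)\<bar>" by (simp only: mult.assoc real_norm_def)
    also have "\<dots> = ?l k" unfolding rec using assms(1) by (simp add: abs_mult)
    finally show "?l k = ?r k" by simp
  qed
  finally have "summable (\<lambda>k. norm (?p k * (real k * \<phi> k)))"
    by (subst (asm) summable_Suc_iff)
  then have i2: "integrable (count_space UNIV) (\<lambda>k. ?p k * (real k * \<phi> k))"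
    by (simp only: integrable_count_space_nat_iff)
  then show "integrable (poisson_pmf rate) (\<lambda>k. real k * \<phi> k)"
    by (simp add: measure_pmf_eq_density integrable_density)
  have "(\<integral>k. real k * \<phi> k \<partial>poisson_pmf rate) = (\<integral>k. ?p k * (real k * \<phi> k) \<partial>count_space UNIV)"
    by (simp add: measure_pmf_eq_density integral_density)
  also have "\<dots> = (\<Sum>k. ?p k * (real k * \<phi> k))"
    by (rule integral_count_space_nat[OF i2])
  also have "\<dots> = (\<Sum>k. ?p (Suc k) * (real (Suc k) * \<phi> (Suc k)))"
    using suminf_split_head[of "\<lambda>k. ?p k * (real k * \<phi> k)"] i2
    by (simp add: integrable_count_space_nat_iff summable_norm_cancel del: pmf_poisson)
  also have "\<dots> = (\<Sum>k. rate * (?p k * \<phi> (Suc k)))"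
    by (simp only: mult.assoc[symmetric] rec)
  also have "\<dots> = rate * (\<Sum>k. ?p k * \<phi> (Suc k))"
    using i1 by (intro suminf_mult) (simp add: integrable_count_space_nat_iff summable_norm_cancel)
  also have "(\<Sum>k. ?p k * \<phi> (Suc k)) = (\<integral>k. ?p k * \<phi> (Suc k) \<partial>count_space UNIV)"
    by (rule integral_count_space_nat[OF i1, symmetric])
  also have "\<dots> = (\<integral>k. \<phi> (Suc k) \<partial>poisson_pmf rate)"
    by (simp add: measure_pmf_eq_density integral_density)
  finally show "(\<integral>k. real k * \<phi> k \<partial>poisson_pmf rate) = rate * (\<integral>k. \<phi> (Suc k) \<partial>poisson_pmf rate)" .
qed

text \<open>
  Conditioning on \<open>Z\<close> reduces the claim to the Poisson identity for \<open>\<phi> z\<close>. Independence is stated as a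
  product form of the joint law, since \<open>Z\<close> and \<open>P\<close> take values in different types.
\<close>
lemma (in prob_space) poisson_stein_indep:
  fixes \<phi> :: "'z \<Rightarrow> nat \<Rightarrow> real"
  assumes "0 < rate"
    and rv[measurable]: "random_variable S Z" "random_variable (count_space UNIV) P"
    and joint: "distr M S Z \<Otimes>\<^sub>M measure_pmf (poisson_pmf rate)
                  = distr M (S \<Otimes>\<^sub>M count_space UNIV) (\<lambda>\<omega>. (Z \<omega>, P \<omega>))"
    and \<phi>[measurable]: "case_prod \<phi> \<in> borel_measurable (S \<Otimes>\<^sub>M count_space UNIV)"
    and G[measurable]: "G \<in> borel_measurable S" and bd: "\<And>z p. z \<in> space S \<Longrightarrow> \<bar>\<phi> z p\<bar> \<le> G z"
    and intG: "integrable M (\<lambda>\<omega>. G (Z \<omega>))"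
  shows "integrable M (\<lambda>\<omega>. real (P \<omega>) * \<phi> (Z \<omega>) (P \<omega>))"
    and "expectation (\<lambda>\<omega>. real (P \<omega>) * \<phi> (Z \<omega>) (P \<omega>)) = rate * expectation (\<lambda>\<omega>. \<phi> (Z \<omega>) (Suc (P \<omega>)))"
proof -
  let ?\<pi> = "measure_pmf (poisson_pmf rate)"
  define \<nu> where "\<nu> = distr M S Z"
  note joint = joint[folded \<nu>_def]
  have [measurable_cong]: "sets \<nu> = sets S" by (simp add: \<nu>_def)
  have sp: "space \<nu> = space S" by (simp add: \<nu>_def)
  interpret \<nu>: prob_space \<nu> unfolding \<nu>_def by (rule prob_space_distr) simp
  interpret pair_sigma_finite \<nu> ?\<pi> ..
  have [measurable]: "(\<lambda>(z, p). \<phi> z (Suc p)) \<in> borel_measurable (S \<Otimes>\<^sub>M count_space UNIV)"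
    using measurable_compose[OF _ \<phi>, of "\<lambda>(z, p). (z, Suc p)" "S \<Otimes>\<^sub>M count_space UNIV"]
    by (simp add: case_prod_beta)
  have [measurable]: "(\<lambda>(z, p). real p * \<phi> z p) \<in> borel_measurable (S \<Otimes>\<^sub>M count_space UNIV)"
    using \<phi> by (simp add: case_prod_beta)
  have stein: "integrable ?\<pi> (\<lambda>p. real p * \<phi> z p)"
      "(\<integral>p. real p * \<phi> z p \<partial>?\<pi>) = rate * (\<integral>p. \<phi> z (Suc p) \<partial>?\<pi>)"
      "(\<integral>p. real p * \<bar>\<phi> z p\<bar> \<partial>?\<pi>) = rate * (\<integral>p. \<bar>\<phi> z (Suc p)\<bar> \<partial>?\<pi>)" if "z \<in> space S" for z
    using poisson_pmf_stein[OF assms(1), of "\<phi> z" "G z"] poisson_pmf_stein(2)[OF assms(1), of "\<lambda>p. \<bar>\<phi> z p\<bar>" "G z"]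
      bd[OF that] by auto
  have int_Suc: "integrable M (\<lambda>\<omega>. \<phi> (Z \<omega>) (Suc (P \<omega>)))"
  proof (rule Bochner_Integration.integrable_bound[OF intG])
    show "AE \<omega> in M. norm (\<phi> (Z \<omega>) (Suc (P \<omega>))) \<le> norm (G (Z \<omega>))"
    proof (rule AE_I2)
      fix \<omega> assume "\<omega> \<in> space M"
      then have "Z \<omega> \<in> space S" by (rule measurable_space[OF rv(1)])
      from bd[OF this, of "Suc (P \<omega>)"]
      show "norm (\<phi> (Z \<omega>) (Suc (P \<omega>))) \<le> norm (G (Z \<omega>))" by simp
    qed
    show "(\<lambda>\<omega>. \<phi> (Z \<omega>) (Suc (P \<omega>))) \<in> borel_measurable M"
      using measurable_compose[of "\<lambda>\<omega>. (Z \<omega>, Suc (P \<omega>))" M _ "case_prod \<phi>"] \<phi> by simp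
  qed
  have prod_Suc: "integrable (\<nu> \<Otimes>\<^sub>M ?\<pi>) (\<lambda>(z, p). \<phi> z (Suc p))"
    unfolding joint using int_Suc by (subst integrable_distr_eq) auto
  have prod: "integrable (\<nu> \<Otimes>\<^sub>M ?\<pi>) (\<lambda>(z, p). real p * \<phi> z p)"
  proof (rule Fubini_integrable)
    show "integrable \<nu> (\<lambda>z. \<integral>p. norm (case (z, p) of (z, p) \<Rightarrow> real p * \<phi> z p) \<partial>?\<pi>)"
    proof (rule Bochner_Integration.integrable_bound)
      show "integrable \<nu> (\<lambda>z. rate * G z)"
        unfolding \<nu>_def using intG by (simp add: integrable_distr_eq)
      show "AE z in \<nu>. norm (\<integral>p. norm (case (z, p) of (z, p) \<Rightarrow> real p * \<phi> z p) \<partial>?\<pi>) \<le> norm (rate * G z)"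
      proof (rule AE_I2)
        fix z assume "z \<in> space \<nu>"
        then have z: "z \<in> space S" by (simp add: sp)
        have G0: "0 \<le> G z" using bd[OF z, of 0] by linarith
        have "(\<integral>p. \<bar>\<phi> z (Suc p)\<bar> \<partial>?\<pi>) \<le> (\<integral>p. G z \<partial>?\<pi>)"
          by (rule integral_mono)
             (use bd[OF z] in \<open>auto intro!: measure_pmf.integrable_const_bound[of _ "G z"]\<close>)
        then have "(\<integral>p. \<bar>\<phi> z (Suc p)\<bar> \<partial>?\<pi>) \<le> G z" by simp
        then have "rate * (\<integral>p. \<bar>\<phi> z (Suc p)\<bar> \<partial>?\<pi>) \<le> rate * G z"
          by (rule mult_left_mono) (use assms(1) in simp)
        then show "norm (\<integral>p. norm (case (z, p) of (z, p) \<Rightarrow> real p * \<phi> z p) \<partial>?\<pi>) \<le> norm (rate * G z)"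
          using assms(1) G0 by (simp add: abs_mult stein(3)[OF z])
      qed
    qed (use \<phi> in measurable)
    show "AE z in \<nu>. integrable ?\<pi> (\<lambda>p. case (z, p) of (z, p) \<Rightarrow> real p * \<phi> z p)"
      using stein(1) by (intro AE_I2) (simp add: sp)
  qed measurable
  then show "integrable M (\<lambda>\<omega>. real (P \<omega>) * \<phi> (Z \<omega>) (P \<omega>))"
    unfolding joint by (subst (asm) integrable_distr_eq) auto
  have "expectation (\<lambda>\<omega>. real (P \<omega>) * \<phi> (Z \<omega>) (P \<omega>)) = (\<integral>x. (case x of (z, p) \<Rightarrow> real p * \<phi> z p) \<partial>(\<nu> \<Otimes>\<^sub>M ?\<pi>))"
    unfolding joint by (subst integral_distr) auto
  also have "\<dots> = (\<integral>z. \<integral>p. real p * \<phi> z p \<partial>?\<pi> \<partial>\<nu>)"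
    by (rule integral_fst[OF prod, symmetric])
  also have "\<dots> = (\<integral>z. rate * (\<integral>p. \<phi> z (Suc p) \<partial>?\<pi>) \<partial>\<nu>)"
    by (rule Bochner_Integration.integral_cong) (auto simp: sp stein(2))
  also have "\<dots> = rate * (\<integral>x. (case x of (z, p) \<Rightarrow> \<phi> z (Suc p)) \<partial>(\<nu> \<Otimes>\<^sub>M ?\<pi>))"
    using integral_fst[OF prod_Suc] by simp
  also have "\<dots> = rate * expectation (\<lambda>\<omega>. \<phi> (Z \<omega>) (Suc (P \<omega>)))"
    unfolding joint by (subst integral_distr) auto
  finally show "expectation (\<lambda>\<omega>. real (P \<omega>) * \<phi> (Z \<omega>) (P \<omega>)) = rate * expectation (\<lambda>\<omega>. \<phi> (Z \<omega>) (Suc (P \<omega>)))" .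
qed

lemma (in prob_space) joint_law_compose:
  assumes [measurable]: "X \<in> measurable M S" "Y \<in> measurable M T" "g \<in> measurable S S'" "h \<in> measurable T T'"
    and joint: "distr M S X \<Otimes>\<^sub>M distr M T Y = distr M (S \<Otimes>\<^sub>M T) (\<lambda>\<omega>. (X \<omega>, Y \<omega>))"
  shows "distr M S' (\<lambda>\<omega>. g (X \<omega>)) \<Otimes>\<^sub>M distr M T' (\<lambda>\<omega>. h (Y \<omega>))
           = distr M (S' \<Otimes>\<^sub>M T') (\<lambda>\<omega>. (g (X \<omega>), h (Y \<omega>)))"
proof -
  have "prob_space (distr M T' (\<lambda>\<omega>. h (Y \<omega>)))" by (rule prob_space_distr) simp
  then have sf: "sigma_finite_measure (distr (distr M T Y) T' h)"
    by (simp add: distr_distr comp_def prob_space_imp_sigma_finite)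
  have "distr M S' (\<lambda>\<omega>. g (X \<omega>)) \<Otimes>\<^sub>M distr M T' (\<lambda>\<omega>. h (Y \<omega>))
          = distr (distr M S X) S' g \<Otimes>\<^sub>M distr (distr M T Y) T' h"
    by (simp add: distr_distr comp_def)
  also have "\<dots> = distr (distr M S X \<Otimes>\<^sub>M distr M T Y) (S' \<Otimes>\<^sub>M T') (\<lambda>(x, y). (g x, h y))"
    by (rule pair_measure_distr[OF _ _ sf]) simp_all
  also have "\<dots> = distr M (S' \<Otimes>\<^sub>M T') (\<lambda>\<omega>. (g (X \<omega>), h (Y \<omega>)))"
    unfolding joint by (subst distr_distr) (simp_all add: comp_def)
  finally show ?thesis .
qed

text \<open>
  \<open>W\<close> is a function of \<open>P\<^sub>k\<close> and of the pair formed by \<open>Y\<^sub>k\<close> and the sum \<open>R\<close> of the other summands, and \<open>P\<^sub>k\<close> is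
  independent of that pair. Raising \<open>P\<^sub>k\<close> by one moves \<open>W\<close> by \<open>c Y\<^sub>k\<close>, with the same \<open>Y\<^sub>k\<close> that enters \<open>W\<close>.
\<close>
lemma (in prob_space) poisson_summand_stein:
  fixes P :: "nat \<Rightarrow> 'a \<Rightarrow> nat" and Y :: "nat \<Rightarrow> 'a \<Rightarrow> real" and c rate :: real
  assumes ind: "indep_vars (\<lambda>_. borel) (case_sum (\<lambda>k \<omega>. real (P k \<omega>)) Y) (I <+> I)"
    and I: "finite I" "k \<in> I" and rate: "0 < rate"
    and P: "distr M (count_space UNIV) (P k) = measure_pmf (poisson_pmf rate)"
    and Yk: "integrable M (Y k)"
    and [measurable]: "F \<in> borel_measurable borel" and F: "\<And>x. \<bar>F x\<bar> \<le> a"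
  defines "W \<equiv> \<lambda>\<omega>. c * (\<Sum>j\<in>I. Y j \<omega> * real (P j \<omega>))"
  shows "integrable M (\<lambda>\<omega>. Y k \<omega> * real (P k \<omega>) * F (W \<omega>))"
    and "expectation (\<lambda>\<omega>. Y k \<omega> * real (P k \<omega>) * F (W \<omega>)) = rate * expectation (\<lambda>\<omega>. Y k \<omega> * F (W \<omega> + c * Y k \<omega>))"
proof -
  let ?X = "case_sum (\<lambda>k \<omega>. real (P k \<omega>)) Y"
  define A B where "A = {Inl k :: nat + nat}" and "B = (I <+> I) - {Inl k}"
  define R where "R \<omega> = c * (\<Sum>j\<in>I - {k}. Y j \<omega> * real (P j \<omega>))" for \<omega>
  \<comment> \<open>The summand as a function of \<open>z = (Y\<^sub>k, R)\<close> and \<open>p = P\<^sub>k\<close>.\<close>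
  define \<phi> where "\<phi> = (\<lambda>(y, r) p. y * F (c * (y * real p) + r))"
  have "indep_var (PiM B (\<lambda>_. borel)) (\<lambda>\<omega>. restrict (\<lambda>i. ?X i \<omega>) B)
                  (PiM A (\<lambda>_. borel)) (\<lambda>\<omega>. restrict (\<lambda>i. ?X i \<omega>) A)"
    by (rule indep_var_restrict[OF ind]) (use I in \<open>auto simp: A_def B_def\<close>)
  then have rv: "random_variable (PiM B (\<lambda>_. borel)) (\<lambda>\<omega>. restrict (\<lambda>i. ?X i \<omega>) B)"
      "random_variable (PiM A (\<lambda>_. borel)) (\<lambda>\<omega>. restrict (\<lambda>i. ?X i \<omega>) A)"
    and J: "distr M (PiM B (\<lambda>_. borel)) (\<lambda>\<omega>. restrict (\<lambda>i. ?X i \<omega>) B) \<Otimes>\<^sub>M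
        distr M (PiM A (\<lambda>_. borel)) (\<lambda>\<omega>. restrict (\<lambda>i. ?X i \<omega>) A) =
        distr M (PiM B (\<lambda>_. borel) \<Otimes>\<^sub>M PiM A (\<lambda>_. borel))
          (\<lambda>\<omega>. (restrict (\<lambda>i. ?X i \<omega>) B, restrict (\<lambda>i. ?X i \<omega>) A))"
    unfolding indep_var_distribution_eq by blast+
  \<comment> \<open>Independence is known for the whole family, so the pair and \<open>P\<^sub>k\<close> are read off the two restrictions
    of the family to complementary index sets, where both sides have the same type.\<close>
  define gB where "gB x = (x (Inr k), c * (\<Sum>j\<in>I - {k}. x (Inr j) * x (Inl j)))" for x :: "nat + nat \<Rightarrow> real"
  define gA where "gA x = nat \<lfloor>x (Inl k)\<rfloor>" for x :: "nat + nat \<Rightarrow> real"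
  have comp: "(\<lambda>x. x i) \<in> borel_measurable (PiM B (\<lambda>_. borel :: real measure))" if "i \<in> B" for i
    by (rule measurable_component_singleton[OF that])
  have gB: "gB \<in> measurable (PiM B (\<lambda>_. borel)) (borel \<Otimes>\<^sub>M borel)"
    unfolding gB_def[abs_def]
    by (intro measurable_Pair borel_measurable_times borel_measurable_sum borel_measurable_const comp)
       (use I in \<open>auto simp: B_def\<close>)
  have gA: "gA \<in> measurable (PiM A (\<lambda>_. borel)) (count_space UNIV)"
    using measurable_component_singleton[of "Inl k" A "\<lambda>_. borel :: real measure"]
    unfolding gA_def[abs_def] by (simp add: A_def)
  have gA_eq: "gA (restrict (\<lambda>i. ?X i \<omega>) A) = P k \<omega>" for \<omega>
    by (simp add: gA_def A_def)
  have gB_eq: "gB (restrict (\<lambda>i. ?X i \<omega>) B) = (Y k \<omega>, R \<omega>)" for \<omega>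
  proof -
    have "(\<Sum>j\<in>I - {k}. restrict (\<lambda>i. ?X i \<omega>) B (Inr j) * restrict (\<lambda>i. ?X i \<omega>) B (Inl j))
            = (\<Sum>j\<in>I - {k}. Y j \<omega> * real (P j \<omega>))"
      by (intro sum.cong) (auto simp: B_def)
    then show ?thesis using I(2) by (auto simp: gB_def R_def B_def)
  qed
  have joint: "distr M (borel \<Otimes>\<^sub>M borel) (\<lambda>\<omega>. (Y k \<omega>, R \<omega>)) \<Otimes>\<^sub>M measure_pmf (poisson_pmf rate)
      = distr M ((borel \<Otimes>\<^sub>M borel) \<Otimes>\<^sub>M count_space UNIV) (\<lambda>\<omega>. ((Y k \<omega>, R \<omega>), P k \<omega>))"
    using joint_law_compose[OF rv gB gA J] unfolding gA_eq gB_eq P .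
  have rvZ: "random_variable (borel \<Otimes>\<^sub>M borel) (\<lambda>\<omega>. (Y k \<omega>, R \<omega>))"
    using measurable_compose[OF rv(1) gB] by (simp add: gB_eq)
  have rvP: "random_variable (count_space UNIV) (P k)"
    using measurable_compose[OF rv(2) gA] by (simp add: gA_eq)
  have \<phi>: "case_prod \<phi> \<in> borel_measurable ((borel \<Otimes>\<^sub>M borel) \<Otimes>\<^sub>M count_space UNIV)"
    unfolding \<phi>_def case_prod_beta by measurable
  have G: "(\<lambda>z. a * \<bar>fst z\<bar>) \<in> borel_measurable (borel \<Otimes>\<^sub>M (borel :: real measure))"
    by measurable
  have bd: "\<bar>\<phi> z p\<bar> \<le> a * \<bar>fst z\<bar>" for z p
    using mult_left_mono[OF F[of "c * (fst z * real p) + snd z"], of "\<bar>fst z\<bar>"]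
    by (simp add: \<phi>_def abs_mult mult.commute case_prod_beta)
  have iG: "integrable M (\<lambda>\<omega>. a * \<bar>fst (Y k \<omega>, R \<omega>)\<bar>)" using Yk by simp
  have W: "W \<omega> = c * (Y k \<omega> * real (P k \<omega>)) + R \<omega>" for \<omega>
    unfolding W_def R_def using I by (simp add: sum.remove[of I k] algebra_simps)
  note stein = poisson_stein_indep[OF rate rvZ rvP joint \<phi> G bd iG]
  have e1: "real (P k \<omega>) * \<phi> (Y k \<omega>, R \<omega>) (P k \<omega>) = Y k \<omega> * real (P k \<omega>) * F (W \<omega>)" for \<omega>
    by (simp add: \<phi>_def W)
  have e2: "\<phi> (Y k \<omega>, R \<omega>) (Suc (P k \<omega>)) = Y k \<omega> * F (W \<omega> + c * Y k \<omega>)" for \<omega>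
    by (simp add: \<phi>_def W algebra_simps)
  show "integrable M (\<lambda>\<omega>. Y k \<omega> * real (P k \<omega>) * F (W \<omega>))" using stein(1) unfolding e1 .
  show "expectation (\<lambda>\<omega>. Y k \<omega> * real (P k \<omega>) * F (W \<omega>)) = rate * expectation (\<lambda>\<omega>. Y k \<omega> * F (W \<omega> + c * Y k \<omega>))"
    using stein(2) unfolding e1 e2 .
qed

section \<open>The weighted Poisson sum in the Stein equation\<close>

text \<open>
  On each of the \<open>n\<close> cells, the second-order Taylor bound at the right endpoint costs \<open>b/2 (1/n)\<^sup>2\<close>.
\<close>
lemma riemann_sum_deriv_bound:
  assumes f: "has_lipschitz_deriv a b f f'" and n: "1 \<le> (n::nat)"
  shows "\<bar>f (x + 1) - f x - 1 / real n * (\<Sum>k=1..n. f' (x + real k / real n))\<bar> \<le> b / (2 * real n)"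
proof -
  define d where "d k = f (x + real k / real n) - f (x + real (k - 1) / real n)
                          - 1 / real n * f' (x + real k / real n)" for k
  have "\<bar>d k\<bar> \<le> b / (2 * (real n)\<^sup>2)" if "k \<in> {1..n}" for k
  proof -
    have "real (k - 1) / real n = real k / real n - 1 / real n"
      using that n by (simp add: of_nat_diff field_simps)
    then have "d k = f (x + real k / real n) - f (x + real k / real n - 1 / real n)
                       - 1 / real n * f' (x + real k / real n)"
      by (simp only: d_def add_diff_eq)
    then show ?thesis
      using has_lipschitz_deriv_taylor[OF f, of "x + real k / real n - 1 / real n" "x + real k / real n"]
      by (simp add: power_divide abs_minus_commute algebra_simps)
  qed
  then have "\<bar>\<Sum>k=1..n. d k\<bar> \<le> (\<Sum>k=1..n. b / (2 * (real n)\<^sup>2))"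
    by (intro order.trans[OF sum_abs] sum_mono)
  also have "\<dots> = b / (2 * real n)" using n by (simp add: power2_eq_square)
  also have "(\<Sum>k=1..n. d k) = f (x + 1) - f x - 1 / real n * (\<Sum>k=1..n. f' (x + real k / real n))"
  proof -
    have "(\<Sum>k=1..n. f (x + real k / real n) - f (x + real (k - 1) / real n)) = f (x + 1) - f x"
      using sum_telescope''[of 0 n "\<lambda>k. f (x + real k / real n)"] n by simp
    then show ?thesis
      unfolding d_def by (simp only: sum_subtractf sum_distrib_left)
  qed
  finally show ?thesis .
qed

text \<open>
  The quadratic polynomial \<open>t \<mapsto> E (t |X| - |Y|)\<^sup>2\<close> is non-negative, so its discriminant is not
  positive.
\<close>
lemma (in prob_space) cauchy_schwarz_expectation:
  assumes [measurable]: "random_variable borel X" "random_variable borel Y"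
    and "integrable M (\<lambda>\<omega>. (X \<omega>)\<^sup>2)" "integrable M (\<lambda>\<omega>. (Y \<omega>)\<^sup>2)"
  shows "integrable M (\<lambda>\<omega>. X \<omega> * Y \<omega>)"
    and "expectation (\<lambda>\<omega>. \<bar>X \<omega> * Y \<omega>\<bar>) \<le> sqrt (expectation (\<lambda>\<omega>. (X \<omega>)\<^sup>2) * expectation (\<lambda>\<omega>. (Y \<omega>)\<^sup>2))"
proof -
  have iXY: "integrable M (\<lambda>\<omega>. X \<omega> * Y \<omega>)"
  proof (rule Bochner_Integration.integrable_bound)
    show "integrable M (\<lambda>\<omega>. (X \<omega>)\<^sup>2 + (Y \<omega>)\<^sup>2)" using assms(3,4) by auto
    have "\<bar>x * y\<bar> \<le> x\<^sup>2 + y\<^sup>2" for x y :: real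
    proof -
      have "2 * \<bar>x * y\<bar> \<le> x\<^sup>2 + y\<^sup>2"
        using sum_squares_bound[of "\<bar>x\<bar>" "\<bar>y\<bar>"] by (simp add: abs_mult)
      then show ?thesis by linarith
    qed
    then show "AE \<omega> in M. norm (X \<omega> * Y \<omega>) \<le> norm ((X \<omega>)\<^sup>2 + (Y \<omega>)\<^sup>2)" by simp
  qed simp
  then show "integrable M (\<lambda>\<omega>. X \<omega> * Y \<omega>)" .
  define A where "A = expectation (\<lambda>\<omega>. (X \<omega>)\<^sup>2)"
  define B where "B = expectation (\<lambda>\<omega>. (Y \<omega>)\<^sup>2)"
  define c where "c = expectation (\<lambda>\<omega>. \<bar>X \<omega> * Y \<omega>\<bar>)"
  have A: "0 \<le> A" and B: "0 \<le> B" and c: "0 \<le> c" by (simp_all add: A_def B_def c_def)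
  have quad: "0 \<le> t\<^sup>2 * A - 2 * t * c + B" for t
  proof -
    have "0 \<le> expectation (\<lambda>\<omega>. (t * \<bar>X \<omega>\<bar> - \<bar>Y \<omega>\<bar>)\<^sup>2)" by simp
    also have "(\<lambda>\<omega>. (t * \<bar>X \<omega>\<bar> - \<bar>Y \<omega>\<bar>)\<^sup>2) = (\<lambda>\<omega>. t\<^sup>2 * (X \<omega>)\<^sup>2 - 2 * t * \<bar>X \<omega> * Y \<omega>\<bar> + (Y \<omega>)\<^sup>2)"
      by (auto simp: power2_diff power_mult_distrib abs_mult algebra_simps)
    also have "expectation \<dots> = t\<^sup>2 * A - 2 * t * c + B"
      using assms(3,4) integrable_abs[OF iXY] by (simp add: A_def B_def c_def)
    finally show ?thesis .
  qed
  have "c\<^sup>2 \<le> A * B"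
  proof (cases "A = 0")
    case True
    have "c = 0"
    proof (rule ccontr)
      assume "c \<noteq> 0"
      then show False using quad[of "(B + 1) / (2 * c)"] True by simp
    qed
    then show ?thesis using True by simp
  next
    case False
    then have "0 < A" using A by simp
    then have "0 \<le> A * ((c / A)\<^sup>2 * A - 2 * (c / A) * c + B)"
      using mult_nonneg_nonneg[OF A quad] by blast
    also have "\<dots> = A * B - c\<^sup>2" using \<open>0 < A\<close> by (simp add: field_simps power2_eq_square)
    finally show ?thesis by simp
  qed
  then show "expectation (\<lambda>\<omega>. \<bar>X \<omega> * Y \<omega>\<bar>)
               \<le> sqrt (expectation (\<lambda>\<omega>. (X \<omega>)\<^sup>2) * expectation (\<lambda>\<omega>. (Y \<omega>)\<^sup>2))"
    unfolding A_def[symmetric] B_def[symmetric] c_def[symmetric] by (rule real_le_rsqrt)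
qed

text \<open>
  Two replacements of \<open>Y\<close> by its mean \<open>\<mu>\<close>: in the weight \<open>Y/\<mu>\<close>, which costs \<open>a E|Y - \<mu>|/\<mu>\<close>, and in the
  argument of \<open>F\<close>, which costs \<open>b E|Y (Y - \<mu>)|/(n \<mu>)\<close>. Both means are bounded by Cauchy-Schwarz.
\<close>
lemma (in prob_space) mean_scaled_shift_error:
  fixes \<mu> s n a b :: real
  assumes f: "has_lipschitz_deriv a b f F"
    and [measurable]: "random_variable borel Y" "random_variable borel W"
    and Y2: "integrable M (\<lambda>\<omega>. (Y \<omega>)\<^sup>2)"
    and mean: "expectation Y = \<mu>" and var: "variance Y = s\<^sup>2"
    and pos: "0 < \<mu>" "0 \<le> s" "0 < n"
  shows "\<bar>1 / \<mu> * expectation (\<lambda>\<omega>. Y \<omega> * F (W \<omega> + Y \<omega> / n)) - expectation (\<lambda>\<omega>. F (W \<omega> + \<mu> / n))\<bar>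
           \<le> a * (s / \<mu>) + b / n * (1 / \<mu> * sqrt ((s\<^sup>2 + \<mu>\<^sup>2) * s\<^sup>2))"
proof -
  note [measurable] = has_lipschitz_deriv_measurable[OF f]
  note ab0 = has_lipschitz_deriv_nonneg[OF f] and F = has_lipschitz_derivD(2,3)[OF f]
  have iY: "integrable M Y" by (rule square_integrable_imp_integrable[OF _ Y2]) simp
  have iYc2: "integrable M (\<lambda>\<omega>. (Y \<omega> - \<mu>)\<^sup>2)"
    using iY Y2 by (simp add: power2_diff)
  have EYc2: "expectation (\<lambda>\<omega>. (Y \<omega> - \<mu>)\<^sup>2) = s\<^sup>2" using var mean by simp
  have EY2: "expectation (\<lambda>\<omega>. (Y \<omega>)\<^sup>2) = s\<^sup>2 + \<mu>\<^sup>2"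
    using variance_eq[OF iY Y2] mean var by simp
  have iYc: "integrable M (\<lambda>\<omega>. \<bar>Y \<omega> - \<mu>\<bar>)" using iY by simp
  have EYc: "expectation (\<lambda>\<omega>. \<bar>Y \<omega> - \<mu>\<bar>) \<le> s"
    using cauchy_schwarz_expectation(2)[of "\<lambda>\<omega>. Y \<omega> - \<mu>" "\<lambda>_. 1"] iYc2 EYc2 pos prob_space by simp
  have iYYc: "integrable M (\<lambda>\<omega>. \<bar>Y \<omega> * (Y \<omega> - \<mu>)\<bar>)"
    by (intro integrable_abs cauchy_schwarz_expectation(1) Y2 iYc2) simp_all
  have EYYc: "expectation (\<lambda>\<omega>. \<bar>Y \<omega> * (Y \<omega> - \<mu>)\<bar>) \<le> sqrt ((s\<^sup>2 + \<mu>\<^sup>2) * s\<^sup>2)"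
    using cauchy_schwarz_expectation(2)[of Y "\<lambda>\<omega>. Y \<omega> - \<mu>"] Y2 iYc2 EYc2 EY2 by simp
  have regroup: "a / \<mu> * x + b / (n * \<mu>) * q = a * (x / \<mu>) + b / n * (1 / \<mu> * q)" for x q
    by simp
  have i1: "integrable M (\<lambda>\<omega>. Y \<omega> * F (W \<omega> + Y \<omega> / n))"
  proof (rule Bochner_Integration.integrable_bound)
    show "integrable M (\<lambda>\<omega>. a * \<bar>Y \<omega>\<bar>)" using iY by simp
    show "AE \<omega> in M. norm (Y \<omega> * F (W \<omega> + Y \<omega> / n)) \<le> norm (a * \<bar>Y \<omega>\<bar>)"
    proof (rule AE_I2)
      fix \<omega>
      have "norm (Y \<omega> * F (W \<omega> + Y \<omega> / n)) = \<bar>F (W \<omega> + Y \<omega> / n)\<bar> * \<bar>Y \<omega>\<bar>"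
        by (simp add: abs_mult)
      also have "\<dots> \<le> a * \<bar>Y \<omega>\<bar>" by (rule mult_right_mono[OF F(1)]) simp
      finally show "norm (Y \<omega> * F (W \<omega> + Y \<omega> / n)) \<le> norm (a * \<bar>Y \<omega>\<bar>)" by simp
    qed
  qed measurable
  have i2: "integrable M (\<lambda>\<omega>. F (W \<omega> + \<mu> / n))"
  proof (rule integrable_const_bound)
    show "AE \<omega> in M. norm (F (W \<omega> + \<mu> / n)) \<le> a" using F(1) by simp
  qed measurable
  have diff: "1 / \<mu> * expectation (\<lambda>\<omega>. Y \<omega> * F (W \<omega> + Y \<omega> / n)) - expectation (\<lambda>\<omega>. F (W \<omega> + \<mu> / n))
        = expectation (\<lambda>\<omega>. 1 / \<mu> * (Y \<omega> * F (W \<omega> + Y \<omega> / n)) - F (W \<omega> + \<mu> / n))"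
    using i1 i2 by simp
  have "\<bar>expectation (\<lambda>\<omega>. 1 / \<mu> * (Y \<omega> * F (W \<omega> + Y \<omega> / n)) - F (W \<omega> + \<mu> / n))\<bar>
          \<le> expectation (\<lambda>\<omega>. a / \<mu> * \<bar>Y \<omega> - \<mu>\<bar> + b / (n * \<mu>) * \<bar>Y \<omega> * (Y \<omega> - \<mu>)\<bar>)"
  proof (rule abs_integral_le_AE)
    show "integrable M (\<lambda>\<omega>. a / \<mu> * \<bar>Y \<omega> - \<mu>\<bar> + b / (n * \<mu>) * \<bar>Y \<omega> * (Y \<omega> - \<mu>)\<bar>)"
      by (intro Bochner_Integration.integrable_add integrable_mult_right iYc iYYc)
    show "AE \<omega> in M. \<bar>1 / \<mu> * (Y \<omega> * F (W \<omega> + Y \<omega> / n)) - F (W \<omega> + \<mu> / n)\<bar>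
             \<le> a / \<mu> * \<bar>Y \<omega> - \<mu>\<bar> + b / (n * \<mu>) * \<bar>Y \<omega> * (Y \<omega> - \<mu>)\<bar>"
    proof (rule AE_I2)
      fix \<omega>
      let ?y = "Y \<omega>" and ?u = "F (W \<omega> + Y \<omega> / n)" and ?v = "F (W \<omega> + \<mu> / n)"
      have "1 / \<mu> * (?y * ?u) - ?v = 1 / \<mu> * (?y - \<mu>) * ?v + 1 / \<mu> * ?y * (?u - ?v)"
        using pos by (simp add: field_simps)
      also have "\<bar>\<dots>\<bar> \<le> 1 / \<mu> * \<bar>?y - \<mu>\<bar> * \<bar>?v\<bar> + 1 / \<mu> * \<bar>?y\<bar> * \<bar>?u - ?v\<bar>"
        using pos by (intro order.trans[OF abs_triangle_ineq]) (simp add: abs_mult)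
      also have "\<dots> \<le> 1 / \<mu> * \<bar>?y - \<mu>\<bar> * a + 1 / \<mu> * \<bar>?y\<bar> * (b * \<bar>?y / n - \<mu> / n\<bar>)"
        using F(1)[of "W \<omega> + \<mu> / n"] F(2)[of "W \<omega> + ?y / n" "W \<omega> + \<mu> / n"] pos
        by (intro add_mono mult_left_mono) auto
      also have "\<bar>?y / n - \<mu> / n\<bar> = \<bar>?y - \<mu>\<bar> / n"
        using pos by (simp flip: diff_divide_distrib)
      finally show "\<bar>1 / \<mu> * (?y * ?u) - ?v\<bar> \<le> a / \<mu> * \<bar>?y - \<mu>\<bar> + b / (n * \<mu>) * \<bar>?y * (?y - \<mu>)\<bar>"
        by (simp add: abs_mult mult_ac)
    qed
  qed (use i1 i2 in simp)
  also have "\<dots> = a / \<mu> * expectation (\<lambda>\<omega>. \<bar>Y \<omega> - \<mu>\<bar>)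
                    + b / (n * \<mu>) * expectation (\<lambda>\<omega>. \<bar>Y \<omega> * (Y \<omega> - \<mu>)\<bar>)"
    by (subst Bochner_Integration.integral_add)
       (intro integrable_mult_right iYc iYYc, intro integrable_mult_right iYc iYYc, simp only: integral_mult_right_zero)
  also have "\<dots> \<le> a / \<mu> * s + b / (n * \<mu>) * sqrt ((s\<^sup>2 + \<mu>\<^sup>2) * s\<^sup>2)"
    by (intro add_mono mult_left_mono EYc EYYc) (use ab0 pos in simp_all)
  also have "\<dots> = a * (s / \<mu>) + b / n * (1 / \<mu> * sqrt ((s\<^sup>2 + \<mu>\<^sup>2) * s\<^sup>2))"
    by (rule regroup)
  finally show "\<bar>1 / \<mu> * expectation (\<lambda>\<omega>. Y \<omega> * F (W \<omega> + Y \<omega> / n)) - expectation (\<lambda>\<omega>. F (W \<omega> + \<mu> / n))\<bar>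
           \<le> a * (s / \<mu>) + b / n * (1 / \<mu> * sqrt ((s\<^sup>2 + \<mu>\<^sup>2) * s\<^sup>2))"
    unfolding diff .
qed

text \<open>
  By the Poisson identity, \<open>E[(W/\<theta>) F(W)]\<close> is the average over \<open>k\<close> of \<open>e k = E[(Y\<^sub>k/k) F(W + Y\<^sub>k/n)]\<close>. With
  \<open>d k = E[F(W + k/n)]\<close>, the expectation on the left becomes the average of the differences
  \<open>e k - d k\<close> minus the expected error \<open>r\<close> of the Riemann sum.
\<close>
lemma (in prob_space) weighted_poisson_stein_bound:
  fixes P :: "nat \<Rightarrow> 'a \<Rightarrow> nat" and Y :: "nat \<Rightarrow> 'a \<Rightarrow> real" and \<sigma> :: "nat \<Rightarrow> real"
    and \<theta> :: real and n :: nat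
  defines "W \<equiv> \<lambda>\<omega>. 1 / real n * (\<Sum>k=1..n. Y k \<omega> * real (P k \<omega>))"
  assumes \<theta>: "0 < \<theta>" and n: "1 \<le> n"
    and ind: "indep_vars (\<lambda>_. borel) (case_sum (\<lambda>k \<omega>. real (P k \<omega>)) Y) ({1..n} <+> {1..n})"
    and P: "\<And>k. k \<in> {1..n} \<Longrightarrow> distr M (count_space UNIV) (P k) = measure_pmf (poisson_pmf (\<theta> / real k))"
    and Y2: "\<And>k. k \<in> {1..n} \<Longrightarrow> integrable M (\<lambda>\<omega>. (Y k \<omega>)\<^sup>2)"
    and mean: "\<And>k. k \<in> {1..n} \<Longrightarrow> expectation (Y k) = real k"
    and var: "\<And>k. k \<in> {1..n} \<Longrightarrow> \<sigma> k \<ge> 0 \<and> variance (Y k) = (\<sigma> k)\<^sup>2"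
  shows "integrable M W"
    and "has_lipschitz_deriv a b f F \<Longrightarrow>
      \<bar>expectation (\<lambda>\<omega>. W \<omega> / \<theta> * F (W \<omega>) + f (W \<omega>) - f (W \<omega> + 1))\<bar>
        \<le> b / (2 * real n) + a / real n * (\<Sum>k=1..n. \<sigma> k / real k)
          + b / (real n)\<^sup>2 * (\<Sum>k=1..n. 1 / real k * sqrt (((\<sigma> k)\<^sup>2 + (real k)\<^sup>2) * (\<sigma> k)\<^sup>2))"
proof -
  have Ym: "random_variable borel (Y k)" if "k \<in> {1..n}" for k
    using ind that unfolding indep_vars_def by (force dest: bspec[of _ _ "Inr k"])
  have iY: "integrable M (Y k)" if "k \<in> {1..n}" for k
    by (rule square_integrable_imp_integrable[OF Ym Y2]) (use that in auto)
  have rate: "0 < \<theta> / real k" if "k \<in> {1..n}" for k using \<theta> that by simp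
  have summand: "integrable M (\<lambda>\<omega>. Y k \<omega> * real (P k \<omega>) * G (W \<omega>))"
    "expectation (\<lambda>\<omega>. Y k \<omega> * real (P k \<omega>) * G (W \<omega>))
       = \<theta> / real k * expectation (\<lambda>\<omega>. Y k \<omega> * G (W \<omega> + Y k \<omega> / real n))"
    if "k \<in> {1..n}" "G \<in> borel_measurable borel" "\<And>x. \<bar>G x\<bar> \<le> a" for k G a
    using poisson_summand_stein[OF ind _ that(1) rate[OF that(1)] P[OF that(1)] iY[OF that(1)] that(2,3),
        of "1 / real n"]
    by (simp_all add: W_def)
  \<comment> \<open>The constant function \<open>1\<close> in place of \<open>F\<close> gives the integrability of each summand.\<close>
  have "integrable M (\<lambda>\<omega>. Y k \<omega> * real (P k \<omega>) * 1)" if "k \<in> {1..n}" for k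
    by (rule summand(1)[OF that, of "\<lambda>_. 1" 1]) auto
  then have "integrable M (\<lambda>\<omega>. Y k \<omega> * real (P k \<omega>))" if "k \<in> {1..n}" for k
    using that by simp
  then show iW: "integrable M W"
    unfolding W_def by (intro integrable_mult_right Bochner_Integration.integrable_sum)
  have [measurable]: "random_variable borel W" using iW by auto
  assume f: "has_lipschitz_deriv a b f F"
  note [measurable] = has_lipschitz_deriv_measurable[OF f]
  note Fb = has_lipschitz_derivD(2)[OF f]
  have iF: "integrable M (\<lambda>\<omega>. F (W \<omega> + c))" for c
  proof (rule integrable_const_bound)
    show "AE \<omega> in M. norm (F (W \<omega> + c)) \<le> a" using Fb by simp
  qed measurable
  have if0: "integrable M (\<lambda>\<omega>. f (W \<omega>))" by (rule has_lipschitz_deriv_integrable[OF f iW])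
  have if1: "integrable M (\<lambda>\<omega>. f (W \<omega> + 1))"
    by (rule has_lipschitz_deriv_integrable[OF has_lipschitz_deriv_shift[OF f] iW])
  have WF: "W \<omega> / \<theta> * F (W \<omega>) = 1 / real n * (\<Sum>k=1..n. 1 / \<theta> * (Y k \<omega> * real (P k \<omega>) * F (W \<omega>)))" for \<omega>
  proof -
    have "W \<omega> / \<theta> * F (W \<omega>) = 1 / real n * ((\<Sum>k=1..n. Y k \<omega> * real (P k \<omega>)) * (1 / \<theta> * F (W \<omega>)))"
      by (simp add: W_def)
    then show ?thesis by (simp add: sum_distrib_right sum_distrib_left mult_ac)
  qed
  have i1: "integrable M (\<lambda>\<omega>. 1 / \<theta> * (Y k \<omega> * real (P k \<omega>) * F (W \<omega>)))" if "k \<in> {1..n}" for k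
    by (rule integrable_mult_right, rule summand(1)[OF that _ Fb]) measurable
  have iWF: "integrable M (\<lambda>\<omega>. W \<omega> / \<theta> * F (W \<omega>))"
    unfolding WF by (intro integrable_mult_right Bochner_Integration.integrable_sum i1)
  define e where "e k = 1 / real k * expectation (\<lambda>\<omega>. Y k \<omega> * F (W \<omega> + Y k \<omega> / real n))" for k
  define d where "d k = expectation (\<lambda>\<omega>. F (W \<omega> + real k / real n))" for k
  define q where "q k = 1 / real k * sqrt (((\<sigma> k)\<^sup>2 + (real k)\<^sup>2) * (\<sigma> k)\<^sup>2)" for k
  have EWF: "expectation (\<lambda>\<omega>. W \<omega> / \<theta> * F (W \<omega>)) = 1 / real n * (\<Sum>k=1..n. e k)"
  proof -
    have "expectation (\<lambda>\<omega>. W \<omega> / \<theta> * F (W \<omega>))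
        = 1 / real n * (\<Sum>k=1..n. expectation (\<lambda>\<omega>. 1 / \<theta> * (Y k \<omega> * real (P k \<omega>) * F (W \<omega>))))"
      unfolding WF by (subst integral_mult_right_zero, subst Bochner_Integration.integral_sum) (use i1 in auto)
    also have "(\<Sum>k=1..n. expectation (\<lambda>\<omega>. 1 / \<theta> * (Y k \<omega> * real (P k \<omega>) * F (W \<omega>)))) = (\<Sum>k=1..n. e k)"
    proof (rule sum.cong[OF refl])
      fix k assume k: "k \<in> {1..n}"
      have "expectation (\<lambda>\<omega>. Y k \<omega> * real (P k \<omega>) * F (W \<omega>))
              = \<theta> / real k * expectation (\<lambda>\<omega>. Y k \<omega> * F (W \<omega> + Y k \<omega> / real n))"
        by (rule summand(2)[OF k _ Fb]) measurable
      then show "expectation (\<lambda>\<omega>. 1 / \<theta> * (Y k \<omega> * real (P k \<omega>) * F (W \<omega>))) = e k"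
        using \<theta> unfolding integral_mult_right_zero e_def by simp
    qed
    finally show ?thesis .
  qed
  define r where "r \<omega> = f (W \<omega> + 1) - f (W \<omega>) - 1 / real n * (\<Sum>k=1..n. F (W \<omega> + real k / real n))" for \<omega>
  have ir: "integrable M r"
    unfolding r_def[abs_def]
    by (intro Bochner_Integration.integrable_diff if0 if1 integrable_mult_right Bochner_Integration.integrable_sum iF)
  have Er: "expectation r = expectation (\<lambda>\<omega>. f (W \<omega> + 1)) - expectation (\<lambda>\<omega>. f (W \<omega>)) - 1 / real n * (\<Sum>k=1..n. d k)"
    unfolding r_def[abs_def] d_def using if0 if1 iF by simp
  have "\<bar>expectation r\<bar> \<le> expectation (\<lambda>\<omega>. b / (2 * real n))"
    by (rule abs_integral_le_AE[OF ir])
       (use riemann_sum_deriv_bound[OF f n] in \<open>auto simp: r_def\<close>)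
  then have r_le: "\<bar>expectation r\<bar> \<le> b / (2 * real n)" by (simp add: prob_space)
  have ed: "\<bar>e k - d k\<bar> \<le> a * (\<sigma> k / real k) + b / real n * q k" if k: "k \<in> {1..n}" for k
    unfolding e_def d_def q_def
    by (rule mean_scaled_shift_error[OF f Ym[OF k]])
       (use k n Y2[OF k] mean[OF k] var[OF k] in auto)
  have "\<bar>1 / real n * (\<Sum>k=1..n. e k - d k)\<bar> \<le> 1 / real n * (\<Sum>k=1..n. a * (\<sigma> k / real k) + b / real n * q k)"
  proof -
    have "\<bar>\<Sum>k=1..n. e k - d k\<bar> \<le> (\<Sum>k=1..n. \<bar>e k - d k\<bar>)" by (rule sum_abs)
    also have "\<dots> \<le> (\<Sum>k=1..n. a * (\<sigma> k / real k) + b / real n * q k)"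
      by (rule sum_mono) (rule ed)
    finally show ?thesis unfolding abs_mult by (intro mult_mono) auto
  qed
  also have "\<dots> = a / real n * (\<Sum>k=1..n. \<sigma> k / real k) + b / (real n)\<^sup>2 * (\<Sum>k=1..n. q k)"
    unfolding sum.distrib sum_distrib_left[symmetric] distrib_left by (simp add: power2_eq_square)
  finally have ed_le: "\<bar>1 / real n * (\<Sum>k=1..n. e k - d k)\<bar>
      \<le> a / real n * (\<Sum>k=1..n. \<sigma> k / real k) + b / (real n)\<^sup>2 * (\<Sum>k=1..n. q k)" .
  have "expectation (\<lambda>\<omega>. W \<omega> / \<theta> * F (W \<omega>) + f (W \<omega>) - f (W \<omega> + 1))
      = expectation (\<lambda>\<omega>. W \<omega> / \<theta> * F (W \<omega>)) + expectation (\<lambda>\<omega>. f (W \<omega>)) - expectation (\<lambda>\<omega>. f (W \<omega> + 1))"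
    by (subst Bochner_Integration.integral_diff[OF Bochner_Integration.integrable_add[OF iWF if0] if1],
        subst Bochner_Integration.integral_add[OF iWF if0]) (rule refl)
  also have "\<dots> = 1 / real n * (\<Sum>k=1..n. e k - d k) - expectation r"
    unfolding EWF Er sum_subtractf by (simp add: algebra_simps)
  finally have "\<bar>expectation (\<lambda>\<omega>. W \<omega> / \<theta> * F (W \<omega>) + f (W \<omega>) - f (W \<omega> + 1))\<bar>
      = \<bar>1 / real n * (\<Sum>k=1..n. e k - d k) - expectation r\<bar>" by (rule arg_cong)
  then show "\<bar>expectation (\<lambda>\<omega>. W \<omega> / \<theta> * F (W \<omega>) + f (W \<omega>) - f (W \<omega> + 1))\<bar>
        \<le> b / (2 * real n) + a / real n * (\<Sum>k=1..n. \<sigma> k / real k)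
          + b / (real n)\<^sup>2 * (\<Sum>k=1..n. 1 / real k * sqrt (((\<sigma> k)\<^sup>2 + (real k)\<^sup>2) * (\<sigma> k)\<^sup>2))"
    unfolding q_def[symmetric] using r_le ed_le by linarith
qed

section \<open>The bound on the distance\<close>

text \<open>
  Passes from the restricted mean of a test function to the ordinary mean of its extension.
\<close>
lemma mean_of_eq_expectation:
  assumes [measurable]: "X \<in> borel_measurable M" "g \<in> borel_measurable borel"
    and X: "AE \<omega> in M. 0 \<le> X \<omega>" and h: "\<And>x. 0 \<le> x \<Longrightarrow> g x = h x"
  shows "mean_of M X h = (\<integral>\<omega>. g (X \<omega>) \<partial>M)"
proof -
  have "mean_of M X h = (\<integral>x. indicator {0..} x * g x \<partial>distr M borel X)"
    unfolding mean_of_def set_lebesgue_integral_def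
    by (rule Bochner_Integration.integral_cong) (auto simp: h indicator_def)
  also have "\<dots> = (\<integral>\<omega>. indicator {0..} (X \<omega>) * g (X \<omega>) \<partial>M)" by (rule integral_distr) measurable
  also have "\<dots> = (\<integral>\<omega>. g (X \<omega>) \<partial>M)"
    by (rule integral_cong_AE) (use X in \<open>auto simp: indicator_def\<close>)
  finally show ?thesis .
qed

theorem theorem1p2:
  fixes M :: "'a measure" and N :: "'b measure"
    and P :: "nat \<Rightarrow> 'a \<Rightarrow> nat" and Y :: "nat \<Rightarrow> 'a \<Rightarrow> real"
    and D :: "'b \<Rightarrow> real" and \<sigma> :: "nat \<Rightarrow> real" and \<theta> :: real and n :: nat
  assumes "\<theta> > 0" and "n \<ge> 1"
    and "prob_space M" and "prob_space N"
    and "prob_space.indep_vars M (\<lambda>_. borel)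
           (case_sum (\<lambda>k \<omega>. real (P k \<omega>)) Y) ({1..n} <+> {1..n})"
    and "\<And>k. k \<in> {1..n} \<Longrightarrow>
           distr M (count_space UNIV) (P k) = measure_pmf (poisson_pmf (\<theta> / real k))"
    and "\<And>k. k \<in> {1..n} \<Longrightarrow> AE \<omega> in M. 0 \<le> Y k \<omega>"
    and "\<And>k. k \<in> {1..n} \<Longrightarrow> integrable M (\<lambda>\<omega>. (Y k \<omega>)\<^sup>2)"
    and "\<And>k. k \<in> {1..n} \<Longrightarrow> prob_space.expectation M (Y k) = real k"
    and "\<And>k. k \<in> {1..n} \<Longrightarrow> \<sigma> k \<ge> 0 \<and> prob_space.variance M (Y k) = (\<sigma> k)\<^sup>2"
    and "D \<in> borel_measurable N" and "generalized_dickman \<theta> (distr N borel D)"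
  shows "d11 M (\<lambda>\<omega>. 1 / real n * (\<Sum>k=1..n. Y k \<omega> * real (P k \<omega>))) N D
           \<le> ereal (\<theta> / (4 * real n)
               + \<theta> / real n * (\<Sum>k=1..n. \<sigma> k / real k)
               + \<theta> / (2 * (real n)\<^sup>2)
                   * (\<Sum>k=1..n. 1 / real k * sqrt (((\<sigma> k)\<^sup>2 + (real k)\<^sup>2) * (\<sigma> k)\<^sup>2)))
         \<and> ((\<forall>k\<in>{1..n}. AE \<omega> in M. Y k \<omega> = real k) \<longrightarrow>
             d11 M (\<lambda>\<omega>. 1 / real n * (\<Sum>k=1..n. real k * real (P k \<omega>))) N D
               \<le> ereal (\<theta> / (4 * real n)))"
proof -
  interpret prob_space M by fact
  interpret N: prob_space N by fact
  note [measurable] = \<open>D \<in> borel_measurable N\<close>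
  have Ym: "Y k \<in> borel_measurable M" and Pm: "(\<lambda>\<omega>. real (P k \<omega>)) \<in> borel_measurable M"
    if "k \<in> {1..n}" for k
    using assms(5) that unfolding indep_vars_def
    by (force dest: bspec[of _ _ "Inr k"], force dest: bspec[of _ _ "Inl k"])
  define W where "W \<omega> = 1 / real n * (\<Sum>k=1..n. Y k \<omega> * real (P k \<omega>))" for \<omega>
  define B where "B = \<theta> / (4 * real n) + \<theta> / real n * (\<Sum>k=1..n. \<sigma> k / real k)
               + \<theta> / (2 * (real n)\<^sup>2) * (\<Sum>k=1..n. 1 / real k * sqrt (((\<sigma> k)\<^sup>2 + (real k)\<^sup>2) * (\<sigma> k)\<^sup>2))"
  have iW: "integrable M W"
    unfolding W_def[abs_def]
    by (rule weighted_poisson_stein_bound(1)[OF assms(1,2,5)]) (fact assms(6,8,9,10))+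
  have stein: "\<bar>\<integral>\<omega>. W \<omega> / \<theta> * F (W \<omega>) + f (W \<omega>) - f (W \<omega> + 1) \<partial>M\<bar> \<le> B"
    if f: "has_lipschitz_deriv \<theta> (\<theta> / 2) f F" for f F
  proof -
    have B_eq: "B = \<theta> / 2 / (2 * real n) + \<theta> / real n * (\<Sum>k=1..n. \<sigma> k / real k)
           + \<theta> / 2 / (real n)\<^sup>2 * (\<Sum>k=1..n. 1 / real k * sqrt (((\<sigma> k)\<^sup>2 + (real k)\<^sup>2) * (\<sigma> k)\<^sup>2))"
      by (simp add: B_def)
    show ?thesis
      unfolding B_eq W_def
      by (rule weighted_poisson_stein_bound(2)[OF assms(1,2,5) _ _ _ _ f]) (fact assms(6,8,9,10))+
  qed
  have [measurable]: "W \<in> borel_measurable M" using iW by auto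
  have "AE \<omega> in M. \<forall>k\<in>{1..n}. 0 \<le> Y k \<omega>"
    by (rule AE_finite_allI) (use assms(7) in auto)
  then have W0: "AE \<omega> in M. 0 \<le> W \<omega>"
    unfolding W_def by eventually_elim (auto intro!: divide_nonneg_nonneg sum_nonneg mult_nonneg_nonneg)
  have "AE w in distr N borel D. 0 \<le> w"
    using assms(12) by (simp add: generalized_dickman_def)
  then have D0: "AE \<omega> in N. 0 \<le> D \<omega>" by (subst (asm) AE_distr_iff) auto
  have main: "d11 M W N D \<le> ereal B"
    unfolding d11_def
  proof (rule SUP_least)
    fix h assume "h \<in> smooth_test 1 1"
    then obtain g g' where g: "has_lipschitz_deriv 1 1 g g'" and gh: "\<And>x. 0 \<le> x \<Longrightarrow> g x = h x"
      by (rule smooth_test_extend) blast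
    note [measurable] = has_lipschitz_deriv_measurable[OF g]
    have "\<bar>(\<integral>w. g w \<partial>distr N borel D) - (\<integral>\<omega>. g (W \<omega>) \<partial>M)\<bar> \<le> B"
      by (rule dickman_distance_from_stein_bound[OF assms(3,1,12) iW stein g])
    also have "(\<integral>w. g w \<partial>distr N borel D) = mean_of N D h"
      by (subst mean_of_eq_expectation[OF _ _ D0 gh]) (auto simp: integral_distr)
    also have "(\<integral>\<omega>. g (W \<omega>) \<partial>M) = mean_of M W h"
      by (subst mean_of_eq_expectation[OF _ _ W0 gh]) auto
    finally show "ereal \<bar>mean_of N D h - mean_of M W h\<bar> \<le> ereal B" by simp
  qed
  moreover have "d11 M (\<lambda>\<omega>. 1 / real n * (\<Sum>k=1..n. real k * real (P k \<omega>))) N D \<le> ereal (\<theta> / (4 * real n))"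
    if eq: "\<forall>k\<in>{1..n}. AE \<omega> in M. Y k \<omega> = real k"
  proof -
    \<comment> \<open>All variances vanish, so only the first term of the general bound remains.\<close>
    have \<sigma>: "\<sigma> k = 0" if k: "k \<in> {1..n}" for k
    proof -
      have "variance (Y k) = (\<integral>\<omega>. 0 \<partial>M)"
        unfolding assms(9)[OF k]
        by (rule integral_cong_AE)
           (use eq k Ym[OF k] in auto)
      then show ?thesis using assms(10)[OF k] by simp
    qed
    have "B = \<theta> / (4 * real n)" unfolding B_def by (simp add: \<sigma>)
    moreover have "d11 M (\<lambda>\<omega>. 1 / real n * (\<Sum>k=1..n. real k * real (P k \<omega>))) N D = d11 M W N D"
    proof -
      have "AE \<omega> in M. \<forall>k\<in>{1..n}. Y k \<omega> = real k"
        by (rule AE_finite_allI) (use eq in auto)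
      then have "AE \<omega> in M. 1 / real n * (\<Sum>k=1..n. real k * real (P k \<omega>)) = W \<omega>"
        unfolding W_def by eventually_elim simp
      moreover have "(\<lambda>\<omega>. 1 / real n * (\<Sum>k=1..n. real k * real (P k \<omega>))) \<in> borel_measurable M"
        by (intro borel_measurable_times borel_measurable_sum borel_measurable_const Pm) auto
      ultimately have "distr M borel (\<lambda>\<omega>. 1 / real n * (\<Sum>k=1..n. real k * real (P k \<omega>))) = distr M borel W"
        by (intro distr_cong_AE) auto
      then show ?thesis by (simp add: d11_def mean_of_def)
    qed
    ultimately show ?thesis using main by simp
  qed
  ultimately show ?thesis unfolding W_def[abs_def] B_def by blast
qed

end
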